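(* Let $G$ be a finitely generated non-virtually cyclic group satisfying a (non-trivial) law. Then $G$ is wide, i.e. none of the asymptotic cones of $G$ has a global cut-point.
   Context: A law is a non-trivial reduced word $w$ in letters $x_1,\dots,x_n$ (and their inverses); a group $G$ satisfies the law $w$ if $w=1$ in $G$ whenever $x_1,\dots,x_n$ are replaced by arbitrary elements of $G$. Asymptotic cones. For a metric space $(X,\mathrm{dist})$, a non-principal ultrafilter $\omega$ over a countable set $I$, points $e=(e_n)_{n\in I}$ of $X$ and positive numbers $d=(d_n)_{n\in I}$ with $\lim_\omega d_n=\infty$, the asymptotic cone $\mathrm{Con}^\omega(X;e,d)$ is the set of sequences $(x_n)$ in $X$ with $\lim_\omega \mathrm{dist}(x_n,e_n)/d_n<\infty$, with pseudo-distance $\lim_\omega \mathrm{dist}(x_n,y_n)/d_n$, modulo pseudo-distance $0$. For a finitely generated group one uses a word metric and $e=(1)$. A global cut-point of a space $Y$ is a point whose complement in $Y$ is not path connected; by convention a one-point space has a cut-point. *)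

theory Defs
  imports "HOL-Analysis.Analysis" "HOL-Algebra.Elementary_Groups"
begin

section \<open>Finite generation, word metrics, virtually cyclic groups\<close>

definition finite_generating_set :: "('a, 'b) monoid_scheme \<Rightarrow> 'a set \<Rightarrow> bool" where
  "finite_generating_set G S \<longleftrightarrow> finite S \<and> S \<subseteq> carrier G \<and> generate G S = carrier G"

definition finitely_generated_group :: "('a, 'b) monoid_scheme \<Rightarrow> bool" where
  "finitely_generated_group G \<longleftrightarrow> group G \<and> (\<exists>S. finite_generating_set G S)"

definition virtually_cyclic :: "('a, 'b) monoid_scheme \<Rightarrow> bool" where
  "virtually_cyclic G \<longleftrightarrow>
     (\<exists>H. subgroup H G \<and> cyclic_group (G\<lparr>carrier := H\<rparr>) \<and> finite (rcosets\<^bsub>G\<^esub> H))"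

definition word_length :: "('a, 'b) monoid_scheme \<Rightarrow> 'a set \<Rightarrow> 'a \<Rightarrow> nat" where
  "word_length G S g =
     (LEAST n. \<exists>ws. length ws = n \<and> set ws \<subseteq> S \<union> (\<lambda>s. inv\<^bsub>G\<^esub> s) ` S \<and>
                    foldr (\<otimes>\<^bsub>G\<^esub>) ws \<one>\<^bsub>G\<^esub> = g)"

text \<open>The library type \<open>'a metric\<close> asks for nonnegativity and symmetry also outside the carrier;
  the default value \<open>0\<close> there has no other significance.\<close>

definition word_dist :: "('a, 'b) monoid_scheme \<Rightarrow> 'a set \<Rightarrow> 'a \<Rightarrow> 'a \<Rightarrow> real" where
  "word_dist G S g h =
     (if g \<in> carrier G \<and> h \<in> carrier G then real (word_length G S (inv\<^bsub>G\<^esub> g \<otimes>\<^bsub>G\<^esub> h)) else 0)"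

definition word_metric :: "('a, 'b) monoid_scheme \<Rightarrow> 'a set \<Rightarrow> 'a metric" where
  "word_metric G S = metric (carrier G, word_dist G S)"


section \<open>Laws\<close>

text \<open>A word is a list of letters; \<open>(i, True)\<close> stands for \<open>x\<^sub>i\<close> and \<open>(i, False)\<close> for its inverse.\<close>

type_synonym word_in_letters = "(nat \<times> bool) list"

definition reduced_word :: "word_in_letters \<Rightarrow> bool" where
  "reduced_word w \<longleftrightarrow> successively (\<lambda>(i, b) (j, c). \<not> (i = j \<and> b \<noteq> c)) w"

definition is_law :: "nat \<Rightarrow> word_in_letters \<Rightarrow> bool" where
  "is_law n w \<longleftrightarrow> fst ` set w \<subseteq> {1..n} \<and> reduced_word w \<and> w \<noteq> []"

definition word_value :: "('a, 'b) monoid_scheme \<Rightarrow> (nat \<Rightarrow> 'a) \<Rightarrow> word_in_letters \<Rightarrow> 'a" where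
  "word_value G a w =
     foldr (\<otimes>\<^bsub>G\<^esub>) (map (\<lambda>(i, b). if b then a i else inv\<^bsub>G\<^esub> (a i)) w) \<one>\<^bsub>G\<^esub>"

definition satisfies_law :: "('a, 'b) monoid_scheme \<Rightarrow> nat \<Rightarrow> word_in_letters \<Rightarrow> bool" where
  "satisfies_law G n w \<longleftrightarrow> (\<forall>a \<in> {1..n} \<rightarrow> carrier G. word_value G a w = \<one>\<^bsub>G\<^esub>)"


section \<open>Asymptotic cones\<close>

text \<open>An ultrafilter on a set \<open>I\<close> is represented by a filter on the ambient type
  that contains \<open>I\<close>.\<close>

definition nonprincipal_ultrafilter_on :: "'i set \<Rightarrow> 'i filter \<Rightarrow> bool" where
  "nonprincipal_ultrafilter_on I \<omega> \<longleftrightarrow>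
     eventually (\<lambda>i. i \<in> I) \<omega> \<and> \<omega> \<noteq> bot \<and>
     (\<forall>P. eventually P \<omega> \<or> eventually (\<lambda>i. \<not> P i) \<omega>) \<and>
     (\<forall>i \<in> I. \<omega> \<noteq> principal {i})"

definition scaling_sequence :: "'i set \<Rightarrow> 'i filter \<Rightarrow> ('i \<Rightarrow> real) \<Rightarrow> bool" where
  "scaling_sequence I \<omega> d \<longleftrightarrow> (\<forall>i \<in> I. 0 < d i) \<and> filterlim d at_top \<omega>"

text \<open>Along an ultrafilter a nonnegative real sequence always has a limit in \<open>[0,\<infinity>]\<close>,
  so that its limit is finite iff the sequence tends to some real number.\<close>

definition cone_sequences ::
    "'a metric \<Rightarrow> 'i set \<Rightarrow> 'i filter \<Rightarrow> ('i \<Rightarrow> 'a) \<Rightarrow> ('i \<Rightarrow> real) \<Rightarrow> ('i \<Rightarrow> 'a) set" where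
  "cone_sequences X I \<omega> e d =
     {x \<in> I \<rightarrow>\<^sub>E mspace X. \<exists>L::real. ((\<lambda>i. mdist X (x i) (e i) / d i) \<longlongrightarrow> L) \<omega>}"

definition cone_pdist ::
    "'a metric \<Rightarrow> 'i filter \<Rightarrow> ('i \<Rightarrow> real) \<Rightarrow> ('i \<Rightarrow> 'a) \<Rightarrow> ('i \<Rightarrow> 'a) \<Rightarrow> real" where
  "cone_pdist X \<omega> d x y = Lim \<omega> (\<lambda>i. mdist X (x i) (y i) / d i)"

definition cone_rel ::
    "'a metric \<Rightarrow> 'i set \<Rightarrow> 'i filter \<Rightarrow> ('i \<Rightarrow> 'a) \<Rightarrow> ('i \<Rightarrow> real) \<Rightarrow> (('i \<Rightarrow> 'a) \<times> ('i \<Rightarrow> 'a)) set" where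
  "cone_rel X I \<omega> e d =
     {(x, y) \<in> cone_sequences X I \<omega> e d \<times> cone_sequences X I \<omega> e d. cone_pdist X \<omega> d x y = 0}"

definition cone_points ::
    "'a metric \<Rightarrow> 'i set \<Rightarrow> 'i filter \<Rightarrow> ('i \<Rightarrow> 'a) \<Rightarrow> ('i \<Rightarrow> real) \<Rightarrow> ('i \<Rightarrow> 'a) set set" where
  "cone_points X I \<omega> e d = cone_sequences X I \<omega> e d // cone_rel X I \<omega> e d"

definition cone_dist ::
    "'a metric \<Rightarrow> 'i set \<Rightarrow> 'i filter \<Rightarrow> ('i \<Rightarrow> 'a) \<Rightarrow> ('i \<Rightarrow> real) \<Rightarrow>
     ('i \<Rightarrow> 'a) set \<Rightarrow> ('i \<Rightarrow> 'a) set \<Rightarrow> real" where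
  "cone_dist X I \<omega> e d p q =
     (if p \<in> cone_points X I \<omega> e d \<and> q \<in> cone_points X I \<omega> e d
      then cone_pdist X \<omega> d (SOME x. x \<in> p) (SOME y. y \<in> q) else 0)"

definition asymptotic_cone ::
    "'a metric \<Rightarrow> 'i set \<Rightarrow> 'i filter \<Rightarrow> ('i \<Rightarrow> 'a) \<Rightarrow> ('i \<Rightarrow> real) \<Rightarrow> ('i \<Rightarrow> 'a) set metric" where
  "asymptotic_cone X I \<omega> e d = metric (cone_points X I \<omega> e d, cone_dist X I \<omega> e d)"


section \<open>Global cut-points and wide groups\<close>

text \<open>In the library the empty space is path connected, so the convention that a
  one-point space has a cut-point is a separate disjunct.\<close>

definition has_global_cut_point :: "'a topology \<Rightarrow> bool" where
  "has_global_cut_point Y \<longleftrightarrow>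
     (\<exists>p \<in> topspace Y. topspace Y = {p} \<or> \<not> path_connectedin Y (topspace Y - {p}))"

text \<open>All finite generating sets are considered. The type argument is the type of which the
  countable index sets are subsets; HOL does not allow quantifying over it here.\<close>

definition wide :: "'i itself \<Rightarrow> ('a, 'b) monoid_scheme \<Rightarrow> bool" where
  "wide (_ :: 'i itself) G \<longleftrightarrow>
     (\<forall>S (I :: 'i set) \<omega> d.
        finite_generating_set G S \<longrightarrow> countable I \<longrightarrow>
        nonprincipal_ultrafilter_on I \<omega> \<longrightarrow> scaling_sequence I \<omega> d \<longrightarrow>
        \<not> has_global_cut_point
            (mtopology_of (asymptotic_cone (word_metric G S) I \<omega> (\<lambda>_. \<one>\<^bsub>G\<^esub>) d)))"


section \<open>Well-definedness\<close>

text \<open>The word metric and the cone really are metrics, so the constructor \<open>metric\<close> is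
  applied within its intended domain.\<close>

subsection \<open>Word metric\<close>

context group
begin

definition spells :: "'a set \<Rightarrow> 'a list \<Rightarrow> 'a \<Rightarrow> bool" where
  "spells S ws g \<longleftrightarrow> set ws \<subseteq> S \<union> (\<lambda>s. inv s) ` S \<and> foldr (\<otimes>) ws \<one> = g"

lemma word_length_spells: "word_length G S g = (LEAST n. \<exists>ws. length ws = n \<and> spells S ws g)"
  by (simp add: word_length_def spells_def)

lemma foldr_mult_closed:
  "set ws \<subseteq> carrier G \<Longrightarrow> foldr (\<otimes>) ws \<one> \<in> carrier G"
  by (induction ws) auto

lemma foldr_mult_append:
  "set us \<subseteq> carrier G \<Longrightarrow> set vs \<subseteq> carrier G \<Longrightarrow>
    foldr (\<otimes>) (us @ vs) \<one> = foldr (\<otimes>) us \<one> \<otimes> foldr (\<otimes>) vs \<one>"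
  by (induction us) (auto simp: m_assoc foldr_mult_closed simp del: foldr_append)

lemma foldr_mult_inv:
  "set us \<subseteq> carrier G \<Longrightarrow>
    foldr (\<otimes>) (rev (map (\<lambda>s. inv s) us)) \<one> = inv (foldr (\<otimes>) us \<one>)"
proof (induction us)
  case (Cons a us)
  have "set (rev (map (\<lambda>s. inv s) us)) \<subseteq> carrier G" "set [inv a] \<subseteq> carrier G"
    using Cons.prems by auto
  from foldr_mult_append[OF this] Cons show ?case
    by (simp add: foldr_mult_closed inv_mult_group del: foldr_append)
qed simp

context
  fixes S assumes S: "S \<subseteq> carrier G"
begin

lemma letters_closed: "S \<union> (\<lambda>s. inv s) ` S \<subseteq> carrier G"
  using S by auto

lemma spells_closed: "spells S ws g \<Longrightarrow> set ws \<subseteq> carrier G"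
  unfolding spells_def using letters_closed by blast

lemma spells_append: "spells S us g \<Longrightarrow> spells S vs h \<Longrightarrow> spells S (us @ vs) (g \<otimes> h)"
  using foldr_mult_append[of us vs] spells_closed unfolding spells_def by auto

lemma spells_inv: "spells S us g \<Longrightarrow> spells S (rev (map (\<lambda>s. inv s) us)) (inv g)"
proof -
  assume a: "spells S us g"
  have "set (rev (map (\<lambda>s. inv s) us)) \<subseteq> S \<union> (\<lambda>s. inv s) ` S"
    using a S unfolding spells_def by (auto simp: subset_iff)
  then show ?thesis
    using foldr_mult_inv[OF spells_closed[OF a]] a unfolding spells_def by simp
qed

lemma spells_exists: "g \<in> generate G S \<Longrightarrow> \<exists>ws. spells S ws g"
proof (induction rule: generate.induct)
  case one
  show ?case by (rule exI[of _ "[]"]) (simp add: spells_def)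
next
  case (incl h)
  then show ?case using S by (intro exI[of _ "[h]"]) (auto simp: spells_def)
next
  case (inv h)
  then show ?case using S by (intro exI[of _ "[inv h]"]) (auto simp: spells_def)
next
  case (eng h1 h2)
  then show ?case using spells_append by blast
qed

lemma word_length_le: "spells S ws g \<Longrightarrow> word_length G S g \<le> length ws"
  unfolding word_length_spells by (rule Least_le) auto

lemma word_length_attained:
  assumes "g \<in> generate G S"
  obtains ws where "length ws = word_length G S g" "spells S ws g"
proof -
  have "\<exists>n. \<exists>ws. length ws = n \<and> spells S ws g" using spells_exists[OF assms] by blast
  from LeastI_ex[OF this] show ?thesis using that unfolding word_length_spells by blast
qed

lemma word_length_inv_le:
  "g \<in> generate G S \<Longrightarrow> word_length G S (inv g) \<le> word_length G S g"
  by (metis word_length_attained word_length_le spells_inv length_rev length_map)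

lemma word_length_mult_le:
  "g \<in> generate G S \<Longrightarrow> h \<in> generate G S \<Longrightarrow>
    word_length G S (g \<otimes> h) \<le> word_length G S g + word_length G S h"
  by (metis word_length_attained word_length_le spells_append length_append)

lemma word_length_one: "word_length G S \<one> = 0"
  using word_length_le[of "[]" \<one>] by (simp add: spells_def)

lemma word_length_eq_0: "g \<in> generate G S \<Longrightarrow> word_length G S g = 0 \<Longrightarrow> g = \<one>"
  by (metis word_length_attained length_0_conv spells_def foldr_Nil id_apply)

end

lemma Metric_space_word_dist:
  assumes "finite_generating_set G S"
  shows "Metric_space (carrier G) (word_dist G S)"
proof -
  have S: "S \<subseteq> carrier G" and gen: "generate G S = carrier G"
    using assms by (auto simp: finite_generating_set_def)
  show ?thesis
  proof
    show "0 \<le> word_dist G S x y" for x y by (simp add: word_dist_def)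
  next
    have le: "word_length G S (inv y \<otimes> x) \<le> word_length G S (inv x \<otimes> y)"
      if "x \<in> carrier G" "y \<in> carrier G" for x y
      using word_length_inv_le[OF S, of "inv x \<otimes> y"] that gen by (simp add: inv_mult_group)
    show "word_dist G S x y = word_dist G S y x" for x y
      using le[of x y] le[of y x] by (auto simp: word_dist_def)
  next
    fix x y assume xy: "x \<in> carrier G" "y \<in> carrier G"
    have "inv x \<otimes> y = \<one> \<longleftrightarrow> x = y"
      using xy by (metis inv_closed inv_equality inv_inv l_inv)
    then show "word_dist G S x y = 0 \<longleftrightarrow> x = y"
      using xy word_length_one[OF S] word_length_eq_0[OF S, of "inv x \<otimes> y"] gen
      by (auto simp: word_dist_def)
  next
    fix x y z assume xyz: "x \<in> carrier G" "y \<in> carrier G" "z \<in> carrier G"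
    have "(inv x \<otimes> y) \<otimes> (inv y \<otimes> z) = inv x \<otimes> z"
      using xyz by (metis inv_closed m_assoc m_closed r_inv l_one)
    then have "word_length G S (inv x \<otimes> z)
        \<le> word_length G S (inv x \<otimes> y) + word_length G S (inv y \<otimes> z)"
      using word_length_mult_le[OF S, of "inv x \<otimes> y" "inv y \<otimes> z"] xyz gen by simp
    then show "word_dist G S x z \<le> word_dist G S x y + word_dist G S y z"
      using xyz by (simp add: word_dist_def)
  qed
qed

lemma word_metric_simps:
  assumes "finite_generating_set G S"
  shows "mspace (word_metric G S) = carrier G" "mdist (word_metric G S) = word_dist G S"
  using Metric_space_word_dist[OF assms]
  by (auto simp: word_metric_def Metric_space.mspace_metric Metric_space.mdist_metric)

end

subsection \<open>Asymptotic cone\<close>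

lemma ultrafilter_bounded_tendsto:
  fixes f :: "'i \<Rightarrow> real"
  assumes u: "nonprincipal_ultrafilter_on I \<omega>" and b: "eventually (\<lambda>i. f i \<in> {a..b}) \<omega>"
  obtains L where "(f \<longlongrightarrow> L) \<omega>"
proof -
  have nb: "filtermap f \<omega> \<noteq> bot"
    using u by (simp add: nonprincipal_ultrafilter_on_def filtermap_bot_iff)
  have "eventually (\<lambda>x. x \<in> {a..b}) (filtermap f \<omega>)" using b by (simp add: eventually_filtermap)
  with nb obtain L where L: "inf (nhds L) (filtermap f \<omega>) \<noteq> bot"
    using compact_Icc[of a b] unfolding compact_filter by blast
  have "(f \<longlongrightarrow> L) \<omega>"
  proof (rule topological_tendstoI, rule ccontr)
    fix U assume U: "open U" "L \<in> U" and n: "\<not> eventually (\<lambda>i. f i \<in> U) \<omega>"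
    then have "eventually (\<lambda>i. f i \<notin> U) \<omega>"
      using u unfolding nonprincipal_ultrafilter_on_def by blast
    then have "eventually (\<lambda>x. x \<notin> U) (filtermap f \<omega>)" by (simp add: eventually_filtermap)
    moreover have "eventually (\<lambda>x. x \<in> U) (nhds L)" using U by (simp add: eventually_nhds) blast
    ultimately have "eventually (\<lambda>x. False) (inf (nhds L) (filtermap f \<omega>))"
      unfolding eventually_inf by blast
    then show False using L by (simp add: eventually_False)
  qed
  then show thesis by (rule that)
qed

context
  fixes X :: "'a metric" and I :: "'i set" and \<omega> e d
  assumes u: "nonprincipal_ultrafilter_on I \<omega>" and s: "scaling_sequence I \<omega> d"
    and e: "\<And>i. i \<in> I \<Longrightarrow> e i \<in> mspace X"
begin

interpretation X: Metric_space "mspace X" "mdist X" by (rule Metric_space_mspace_mdist)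

lemma ev_I: "eventually (\<lambda>i. i \<in> I) \<omega>"
  using u by (simp add: nonprincipal_ultrafilter_on_def)

lemma cone_pdist_tendsto:
  assumes x: "x \<in> cone_sequences X I \<omega> e d" and y: "y \<in> cone_sequences X I \<omega> e d"
  shows "((\<lambda>i. mdist X (x i) (y i) / d i) \<longlongrightarrow> cone_pdist X \<omega> d x y) \<omega>"
proof -
  from x y obtain L M where L: "((\<lambda>i. mdist X (x i) (e i) / d i) \<longlongrightarrow> L) \<omega>"
    and M: "((\<lambda>i. mdist X (y i) (e i) / d i) \<longlongrightarrow> M) \<omega>"
    by (auto simp: cone_sequences_def)
  have "eventually (\<lambda>i. mdist X (x i) (e i) / d i < L + 1) \<omega>"
    "eventually (\<lambda>i. mdist X (y i) (e i) / d i < M + 1) \<omega>"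
    using order_tendstoD(2)[OF L, of "L+1"] order_tendstoD(2)[OF M, of "M+1"] by auto
  then have "eventually (\<lambda>i. mdist X (x i) (y i) / d i \<in> {0..L + M + 2}) \<omega>"
    using ev_I
  proof eventually_elim
    case (elim i)
    have di: "d i > 0" using s elim by (simp add: scaling_sequence_def)
    have "x i \<in> mspace X" "y i \<in> mspace X" using x y elim by (auto simp: cone_sequences_def)
    then have "mdist X (x i) (y i) \<le> mdist X (x i) (e i) + mdist X (y i) (e i)"
      using e elim X.triangle' by blast
    then have "mdist X (x i) (y i) / d i \<le> mdist X (x i) (e i) / d i + mdist X (y i) (e i) / d i"
      using di by (simp add: divide_right_mono flip: add_divide_distrib)
    then show ?case using elim di by simp
  qed
  then obtain K where K: "((\<lambda>i. mdist X (x i) (y i) / d i) \<longlongrightarrow> K) \<omega>"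
    by (rule ultrafilter_bounded_tendsto[OF u])
  have "\<omega> \<noteq> bot" using u by (simp add: nonprincipal_ultrafilter_on_def)
  from tendsto_Lim[OF this K] K show ?thesis by (simp add: cone_pdist_def)
qed

lemma nbot: "\<omega> \<noteq> bot"
  using u by (simp add: nonprincipal_ultrafilter_on_def)

lemma cone_pdist_nonneg:
  assumes "x \<in> cone_sequences X I \<omega> e d" "y \<in> cone_sequences X I \<omega> e d"
  shows "0 \<le> cone_pdist X \<omega> d x y"
proof (rule tendsto_lowerbound[OF cone_pdist_tendsto[OF assms] _ nbot])
  show "eventually (\<lambda>i. 0 \<le> mdist X (x i) (y i) / d i) \<omega>"
    using ev_I by eventually_elim (use s in \<open>auto simp: scaling_sequence_def less_imp_le\<close>)
qed

lemma cone_pdist_refl: "cone_pdist X \<omega> d x x = 0" if "x \<in> cone_sequences X I \<omega> e d"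
proof -
  have "((\<lambda>i. mdist X (x i) (x i) / d i) \<longlongrightarrow> 0) \<omega>"
  proof (rule tendsto_eventually, use ev_I in eventually_elim)
    case (elim i)
    have "x i \<in> mspace X" using that elim by (auto simp: cone_sequences_def)
    then show ?case by simp
  qed
  from tendsto_Lim[OF nbot this] show ?thesis by (simp add: cone_pdist_def)
qed

lemma cone_pdist_commute: "cone_pdist X \<omega> d x y = cone_pdist X \<omega> d y x"
  by (simp add: cone_pdist_def X.commute)

lemma cone_pdist_triangle:
  assumes x: "x \<in> cone_sequences X I \<omega> e d" and y: "y \<in> cone_sequences X I \<omega> e d"
    and z: "z \<in> cone_sequences X I \<omega> e d"
  shows "cone_pdist X \<omega> d x z \<le> cone_pdist X \<omega> d x y + cone_pdist X \<omega> d y z"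
proof (rule tendsto_le[OF nbot tendsto_add[OF cone_pdist_tendsto[OF x y] cone_pdist_tendsto[OF y z]]
      cone_pdist_tendsto[OF x z]], use ev_I in eventually_elim)
  case (elim i)
  have di: "d i > 0" using s elim by (simp add: scaling_sequence_def)
  have "x i \<in> mspace X" "y i \<in> mspace X" "z i \<in> mspace X"
    using x y z elim by (auto simp: cone_sequences_def)
  then show ?case
    using di X.triangle by (simp add: divide_right_mono flip: add_divide_distrib)
qed

lemma equiv_cone_rel: "equiv (cone_sequences X I \<omega> e d) (cone_rel X I \<omega> e d)"
proof (rule equivI)
  show "cone_rel X I \<omega> e d \<subseteq> cone_sequences X I \<omega> e d \<times> cone_sequences X I \<omega> e d"
    by (auto simp: cone_rel_def)
  show "refl_on (cone_sequences X I \<omega> e d) (cone_rel X I \<omega> e d)"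
    by (auto simp: refl_on_def cone_rel_def cone_pdist_refl)
  show "sym (cone_rel X I \<omega> e d)"
    by (auto simp: sym_def cone_rel_def cone_pdist_commute)
  show "trans (cone_rel X I \<omega> e d)"
  proof (rule transI)
    fix x y z assume "(x, y) \<in> cone_rel X I \<omega> e d" "(y, z) \<in> cone_rel X I \<omega> e d"
    then show "(x, z) \<in> cone_rel X I \<omega> e d"
      using cone_pdist_triangle[of x y z] cone_pdist_nonneg[of x z] by (auto simp: cone_rel_def)
  qed
qed

lemma cone_pdist_cong:
  assumes "(x, x') \<in> cone_rel X I \<omega> e d" "(y, y') \<in> cone_rel X I \<omega> e d"
  shows "cone_pdist X \<omega> d x y = cone_pdist X \<omega> d x' y'"
proof -
  have m: "x \<in> cone_sequences X I \<omega> e d" "x' \<in> cone_sequences X I \<omega> e d"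
    "y \<in> cone_sequences X I \<omega> e d" "y' \<in> cone_sequences X I \<omega> e d"
    and z: "cone_pdist X \<omega> d x x' = 0" "cone_pdist X \<omega> d y y' = 0"
    using assms by (auto simp: cone_rel_def)
  show ?thesis
    using cone_pdist_triangle[of x x' y] cone_pdist_triangle[of x' y' y]
      cone_pdist_triangle[of x' x y'] cone_pdist_triangle[of x y y'] m z
      cone_pdist_commute[of x' x] cone_pdist_commute[of y' y] by simp
qed

lemma cone_point_rep:
  assumes "p \<in> cone_points X I \<omega> e d"
  shows "(SOME x. x \<in> p) \<in> p" and "(SOME x. x \<in> p) \<in> cone_sequences X I \<omega> e d"
proof -
  have "p \<noteq> {}" using in_quotient_imp_non_empty[OF equiv_cone_rel] assms by (auto simp: cone_points_def)
  then show 1: "(SOME x. x \<in> p) \<in> p" by (simp add: some_in_eq)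
  show "(SOME x. x \<in> p) \<in> cone_sequences X I \<omega> e d"
    using in_quotient_imp_subset[OF equiv_cone_rel] assms 1 by (auto simp: cone_points_def)
qed

lemma cone_dist_eq:
  assumes "p \<in> cone_points X I \<omega> e d" "q \<in> cone_points X I \<omega> e d" "x \<in> p" "y \<in> q"
  shows "cone_dist X I \<omega> e d p q = cone_pdist X \<omega> d x y"
proof -
  have "((SOME x. x \<in> p), x) \<in> cone_rel X I \<omega> e d" "((SOME x. x \<in> q), y) \<in> cone_rel X I \<omega> e d"
    using in_quotient_imp_in_rel[OF equiv_cone_rel] assms cone_point_rep(1)
    by (auto simp: cone_points_def)
  from cone_pdist_cong[OF this] assms show ?thesis by (simp add: cone_dist_def)
qed

lemma Metric_space_cone: "Metric_space (cone_points X I \<omega> e d) (cone_dist X I \<omega> e d)"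
proof
  show "0 \<le> cone_dist X I \<omega> e d p q" for p q
    using cone_pdist_nonneg cone_point_rep(2) by (auto simp: cone_dist_def)
  show "cone_dist X I \<omega> e d p q = cone_dist X I \<omega> e d q p" for p q
    by (simp add: cone_dist_def cone_pdist_commute)
next
  fix p q assume pq: "p \<in> cone_points X I \<omega> e d" "q \<in> cone_points X I \<omega> e d"
  have "cone_dist X I \<omega> e d p q = 0 \<longleftrightarrow>
      ((SOME x. x \<in> p), (SOME x. x \<in> q)) \<in> cone_rel X I \<omega> e d"
    using pq cone_point_rep(2) by (simp add: cone_dist_def cone_rel_def)
  also have "\<dots> \<longleftrightarrow> p = q"
    using quotient_eq_iff[OF equiv_cone_rel, of p q "SOME x. x \<in> p" "SOME x. x \<in> q"] pq
      cone_point_rep(1)[OF pq(1)] cone_point_rep(1)[OF pq(2)]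
    unfolding cone_points_def by blast
  finally show "cone_dist X I \<omega> e d p q = 0 \<longleftrightarrow> p = q" .
next
  fix p q r
  assume "p \<in> cone_points X I \<omega> e d" "q \<in> cone_points X I \<omega> e d" "r \<in> cone_points X I \<omega> e d"
  then show "cone_dist X I \<omega> e d p r \<le> cone_dist X I \<omega> e d p q + cone_dist X I \<omega> e d q r"
    using cone_pdist_triangle cone_point_rep(2) by (simp add: cone_dist_def)
qed

lemma asymptotic_cone_simps:
  "mspace (asymptotic_cone X I \<omega> e d) = cone_points X I \<omega> e d"
  "mdist (asymptotic_cone X I \<omega> e d) = cone_dist X I \<omega> e d"
  using Metric_space_cone
  by (auto simp: asymptotic_cone_def Metric_space.mspace_metric Metric_space.mdist_metric)

end

end

theory Submission
  imports Defs
begin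

text \<open>
  Fix a finite generating set and suppose that some asymptotic cone \<open>Y\<close> of \<open>G\<close> has a cut-point.
  The sequences in \<open>G\<close> whose length is bounded by a multiple of the scaling sequence form a group
  \<open>\<Gamma>\<close> that acts transitively and isometrically on \<open>Y\<close>, and \<open>\<Gamma>\<close> satisfies every law of \<open>G\<close>. So all
  points of \<open>Y\<close> are cut-points. All that the argument uses about the topology of \<open>Y\<close> is the
  relation "\<open>p\<close> separates \<open>x\<close> from \<open>y\<close>" (no path from \<open>x\<close> to \<open>y\<close> avoids \<open>p\<close>): it is invariant under
  \<open>\<Gamma>\<close>, failing to be separated is transitive, and since \<open>Y\<close> is geodesic, a point that separates
  \<open>x\<close> from \<open>y\<close> lies metrically between them. These properties, pulled back to \<open>\<Gamma>\<close>, are the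
  axioms of the locale \<open>separated_group\<close>. Three cases exhaust the possibilities.

  Suppose that among any three distinct points one separates the other two, so that \<open>Y\<close> looks like
  a line. There is \<open>t \<in> \<Gamma>\<close> with \<open>t\<close> and \<open>t\<^sup>-\<^sup>1\<close> on different sides of \<open>1\<close>, and everything at distance
  less than \<open>D(1,t)\<close> from \<open>1\<close> is within \<open>D(1,t)/2\<close> of \<open>1\<close>, \<open>t\<close> or \<open>t\<^sup>-\<^sup>1\<close>. At a single
  index this says that a ball \<open>B\<close> of \<open>G\<close>, enlarged by one letter, lies in the translates of \<open>B\<close> by
  powers of one element \<open>t\<^sub>i\<close>; hence \<open>G = \<langle>t\<^sub>i\<rangle>B\<close> is virtually cyclic
  (\<open>virtually_cyclic_of_line\<close>).

  Otherwise there are three points none of which separates the other two. Suppose that at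
  every such point some element of \<open>\<Gamma>\<close> and its inverse both lead away from the other two points.
  Conjugating three such elements to the three points gives a table tennis configuration
  that violates every law (\<open>no_law_of_triple\<close>).

  If such elements do not exist, there is a direction \<open>b\<close> at \<open>1\<close>, hence at every point of
  \<open>\<Gamma>\<close> by translation, such that for every \<open>k\<close> one of \<open>k\<close>, \<open>k\<^sup>-\<^sup>1\<close> is not separated from \<open>b\<close>:
  as if \<open>\<Gamma>\<close> fixed an end of \<open>Y\<close>, with \<open>b\<close> pointing to it. Being below another point is then a
  partial order in which the points above a given one form a chain. Conjugation by a high element
  squeezes a ball of radius \<open>R\<close> into the points that are comparable with \<open>1\<close>, a set of linear
  size in \<open>R\<close>, while two incomparable descending elements generate a free semigroup, so that the
  ball contains exponentially many points far from one another. As conjugation is a bijection of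
  \<open>G\<close>, comparing the numbers of elements of the corresponding balls of \<open>G\<close> gives a contradiction
  (\<open>not_ascending\<close>).
\<close>

section \<open>Table tennis and laws\<close>

lemma (in group) inv_mult_cancel [simp]:
  "x \<in> carrier G \<Longrightarrow> y \<in> carrier G \<Longrightarrow> inv x \<otimes> (x \<otimes> y) = y"
  "x \<in> carrier G \<Longrightarrow> y \<in> carrier G \<Longrightarrow> x \<otimes> (inv x \<otimes> y) = y"
  by (simp_all flip: m_assoc)

text \<open>
  The letter \<open>x\<^sub>i\<close> is replaced by \<open>a\<^bsup>2i\<^esup> f a\<^bsup>-(2i+1)\<^esup>\<close>. The exponents \<open>2i\<close> and \<open>2i+1\<close> are different for
  all letters and their inverses, so in the value of a reduced word a nonzero power of \<open>a\<close> remains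
  between any two consecutive occurrences of \<open>f\<close> or \<open>f\<^sup>-\<^sup>1\<close>, and the two sets play table tennis. As \<open>f\<close>
  occurs with exponents \<open>1\<close> and \<open>-1\<close> only, it may be an involution, which happens in free products of
  groups of order two.
\<close>

lemma (in group) table_tennis_no_law:
  assumes law: "is_law n w" and a: "a \<in> carrier G" and f: "f \<in> carrier G"
    and Y: "Y \<subseteq> carrier G" "y0 \<in> Y" and disj: "Y \<inter> Z = {}"
    and aY: "\<And>m::int. \<And>y. m \<noteq> 0 \<Longrightarrow> y \<in> Y \<Longrightarrow> a [^] m \<otimes> y \<in> Z"
    and fZ: "\<And>z. z \<in> Z \<Longrightarrow> f \<otimes> z \<in> Y" "\<And>z. z \<in> Z \<Longrightarrow> inv f \<otimes> z \<in> Y"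
  shows "\<not> satisfies_law G n w"
proof
  assume sat: "satisfies_law G n w"
  define h where "h i = a [^] (2 * int i) \<otimes> f \<otimes> a [^] (- (2 * int i + 1))" for i :: nat
  \<comment> \<open>The value of a letter begins with the power \<open>s\<close> of \<open>a\<close> and ends with the power \<open>-e\<close>.\<close>
  define s where "s l = (case l of (i, b) \<Rightarrow> if b then 2 * int i else 2 * int i + 1)"
    for l :: "nat \<times> bool"
  define e where "e l = (case l of (i, b) \<Rightarrow> if b then 2 * int i + 1 else 2 * int i)"
    for l :: "nat \<times> bool"
  define F where "F l = (if snd l then f else inv f)" for l :: "nat \<times> bool"
  have h: "h i \<in> carrier G" for i using a f by (simp add: h_def)
  have F: "F l \<in> carrier G" for l using f by (simp add: F_def)
  have letter: "(case l of (i, b) \<Rightarrow> if b then h i else inv (h i)) =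
      a [^] s l \<otimes> F l \<otimes> a [^] (- e l)" for l
    using a f by (cases l) (auto simp: h_def s_def e_def F_def inv_mult_group m_assoc add.commute simp flip: int_pow_neg)
  have val_closed: "word_value G h w \<in> carrier G" for w
    unfolding word_value_def by (rule foldr_mult_closed) (auto simp: h)
  have Cons: "word_value G h (l # w) = a [^] s l \<otimes> F l \<otimes> a [^] (- e l) \<otimes> word_value G h w" for l w
    by (simp add: word_value_def letter[symmetric])
  have step: "\<exists>y'\<in>Y. a [^] s l \<otimes> F l \<otimes> a [^] (- e l) \<otimes> (a [^] m \<otimes> y) = a [^] s l \<otimes> y'"
    if y: "y \<in> Y" and m: "m \<noteq> e l" for l m y
  proof -
    have yc: "y \<in> carrier G" using y Y by blast
    have "a [^] (m - e l) \<otimes> y \<in> Z" using aY[of "m - e l" y] m y by simp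
    moreover have "a [^] (- e l) \<otimes> (a [^] m \<otimes> y) = a [^] (m - e l) \<otimes> y"
      using a yc by (simp add: m_assoc[symmetric] int_pow_mult[symmetric])
    ultimately have z: "a [^] (- e l) \<otimes> (a [^] m \<otimes> y) \<in> Z" by simp
    then have "F l \<otimes> (a [^] (- e l) \<otimes> (a [^] m \<otimes> y)) \<in> Y" using fZ by (auto simp: F_def)
    moreover have "a [^] s l \<otimes> F l \<otimes> a [^] (- e l) \<otimes> (a [^] m \<otimes> y)
       = a [^] s l \<otimes> (F l \<otimes> (a [^] (- e l) \<otimes> (a [^] m \<otimes> y)))"
      using a yc F by (simp add: m_assoc)
    ultimately show ?thesis by (rule bexI[rotated])
  qed
  have main: "\<exists>y\<in>Y. word_value G h u \<otimes> y0 = a [^] s (hd u) \<otimes> y"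
    if "u \<noteq> []" "reduced_word u" "fst ` set u \<subseteq> {1..n}" for u
    using that
  proof (induction u)
    case (Cons l u)
    have y0c: "y0 \<in> carrier G" using Y by blast
    have assoc: "word_value G h (l # u) \<otimes> y0 =
      a [^] s l \<otimes> F l \<otimes> a [^] (- e l) \<otimes> (word_value G h u \<otimes> y0)"
      using a F y0c val_closed by (simp add: \<open>\<And>l w. word_value G h (l # w) = _\<close> m_assoc)
    show ?case
    proof (cases u)
      case Nil
      have "e l \<noteq> 0" using Cons.prems by (cases l) (auto simp: e_def)
      then obtain y where "y \<in> Y"
        "a [^] s l \<otimes> F l \<otimes> a [^] (- e l) \<otimes> (a [^] (0::int) \<otimes> y0) = a [^] s l \<otimes> y"
        using step[OF Y(2), of 0 l] by auto
      then show ?thesis using assoc y0c Nil by (auto simp: word_value_def)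
    next
      case (Cons l' v)
      then have "reduced_word u" "\<not> (fst l = fst l' \<and> snd l \<noteq> snd l')"
        using Cons.prems by (auto simp: reduced_word_def split: prod.splits)
      then have ne: "s l' \<noteq> e l"
        by (cases l; cases l') (auto simp: s_def e_def split: if_splits, presburger+)
      obtain y where "y \<in> Y" "word_value G h u \<otimes> y0 = a [^] s l' \<otimes> y"
        using Cons.IH Cons.prems \<open>reduced_word u\<close> Cons by auto
      then show ?thesis using step[OF _ ne] assoc by auto
    qed
  qed simp
  have w: "w \<noteq> []" "reduced_word w" "fst ` set w \<subseteq> {1..n}" using law by (auto simp: is_law_def)
  obtain y where y: "y \<in> Y" "word_value G h w \<otimes> y0 = a [^] s (hd w) \<otimes> y"
    using main[OF w] by blast
  have "fst (hd w) \<in> {1..n}" using w by (metis hd_in_set image_subset_iff)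
  then have "s (hd w) \<noteq> 0" by (cases "hd w") (auto simp: s_def)
  then have "word_value G h w \<otimes> y0 \<in> Z" using aY y by simp
  moreover have "word_value G h w = \<one>" using sat h by (auto simp: satisfies_law_def)
  ultimately show False using disj Y by (metis IntI empty_iff l_one subsetD)
qed

section \<open>Groups with a separation relation\<close>

text \<open>
  \<open>D\<close> is a left invariant pseudometric, and \<open>Sep p x y\<close> is to be read as: \<open>x\<close> and \<open>y\<close> lie at positive
  distance from \<open>p\<close>, in different components of the complement of \<open>p\<close>. The axiom \<open>Sep_cotrans\<close> is
  the transitivity of lying in one component; \<open>Sep_dist\<close> is the trace that geodesics leave.
\<close>

locale separated_group = group G for G (structure) +
  fixes D :: "'a \<Rightarrow> 'a \<Rightarrow> real" and Sep :: "'a \<Rightarrow> 'a \<Rightarrow> 'a \<Rightarrow> bool"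
  assumes D_nonneg: "x \<in> carrier G \<Longrightarrow> y \<in> carrier G \<Longrightarrow> 0 \<le> D x y"
    and D_self [simp]: "x \<in> carrier G \<Longrightarrow> D x x = 0"
    and D_commute: "x \<in> carrier G \<Longrightarrow> y \<in> carrier G \<Longrightarrow> D x y = D y x"
    and D_triangle: "x \<in> carrier G \<Longrightarrow> y \<in> carrier G \<Longrightarrow> z \<in> carrier G \<Longrightarrow> D x z \<le> D x y + D y z"
    and D_left [simp]: "g \<in> carrier G \<Longrightarrow> x \<in> carrier G \<Longrightarrow> y \<in> carrier G \<Longrightarrow> D (g \<otimes> x) (g \<otimes> y) = D x y"
    and Sep_sym: "p \<in> carrier G \<Longrightarrow> x \<in> carrier G \<Longrightarrow> y \<in> carrier G \<Longrightarrow> Sep p x y \<Longrightarrow> Sep p y x"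
    and Sep_cotrans: "p \<in> carrier G \<Longrightarrow> x \<in> carrier G \<Longrightarrow> y \<in> carrier G \<Longrightarrow> z \<in> carrier G \<Longrightarrow>
       Sep p x y \<Longrightarrow> 0 < D p z \<Longrightarrow> Sep p x z \<or> Sep p z y"
    and Sep_dist: "p \<in> carrier G \<Longrightarrow> x \<in> carrier G \<Longrightarrow> y \<in> carrier G \<Longrightarrow> Sep p x y \<Longrightarrow> D x y = D x p + D p y"
    and Sep_pos: "p \<in> carrier G \<Longrightarrow> x \<in> carrier G \<Longrightarrow> y \<in> carrier G \<Longrightarrow> Sep p x y \<Longrightarrow> 0 < D p x"
    and Sep_left_imp: "g \<in> carrier G \<Longrightarrow> p \<in> carrier G \<Longrightarrow> x \<in> carrier G \<Longrightarrow> y \<in> carrier G \<Longrightarrow>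
       Sep p x y \<Longrightarrow> Sep (g \<otimes> p) (g \<otimes> x) (g \<otimes> y)"
    and Sep_one_ex: "\<exists>x\<in>carrier G. \<exists>y\<in>carrier G. Sep \<one> x y"
begin

lemma Sep_left [simp]:
  assumes "g \<in> carrier G" "p \<in> carrier G" "x \<in> carrier G" "y \<in> carrier G"
  shows "Sep (g \<otimes> p) (g \<otimes> x) (g \<otimes> y) \<longleftrightarrow> Sep p x y"
  using assms Sep_left_imp[of g p x y] Sep_left_imp[of "inv g" "g \<otimes> p" "g \<otimes> x" "g \<otimes> y"] by auto

lemma Sep_pos': "p \<in> carrier G \<Longrightarrow> x \<in> carrier G \<Longrightarrow> y \<in> carrier G \<Longrightarrow> Sep p x y \<Longrightarrow> 0 < D p y"
  using Sep_pos Sep_sym by blast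

lemma D_inv: "x \<in> carrier G \<Longrightarrow> D \<one> (inv x) = D \<one> x"
  using D_left[of x \<one> "inv x"] D_commute[of x \<one>] by simp

text \<open>
  Of two points at most one separates the other from a given third point: both cannot be metrically
  between the remaining two.
\<close>

lemma Sep_swap:
  assumes "p \<in> carrier G" "x \<in> carrier G" "y \<in> carrier G" "Sep p x y"
  shows "\<not> Sep x p y"
  using assms Sep_dist[of p x y] Sep_dist[of x p y] Sep_pos[of p x y] D_commute[of x p] by force

text \<open>
  The passage from local to global: if a path of points is separated at two consecutive vertices, the
  first of these vertices separates its predecessor from the successor of the second one.
\<close>

lemma Sep_chain:
  assumes c: "p \<in> carrier G" "x \<in> carrier G" "y \<in> carrier G" "z \<in> carrier G"
    and "Sep p x y" "Sep y p z"
  shows "Sep p x z"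
proof -
  have 1: "D p z = D p y + D y z" using Sep_dist[of y p z] assms by simp
  moreover have y: "0 < D p y" using Sep_pos'[of p x y] assms by simp
  moreover have "0 < D y z" using Sep_pos'[of y p z] assms by simp
  ultimately have "0 < D p z" by simp
  then consider "Sep p x z" | "Sep p z y" using Sep_cotrans[of p x y z] assms by blast
  then show ?thesis
  proof cases
    case 2
    then have "D z y = D z p + D p y" using Sep_dist[of p z y] assms by simp
    then show ?thesis using 1 y D_commute[of z y] D_commute[of z p] c by simp
  qed
qed

subsection \<open>Translations of a line\<close>

text \<open>
  If \<open>1\<close> separates \<open>x\<close> from \<open>y\<close> but neither from its own inverse, then \<open>x\<close> and \<open>y\<close> act like reflections of
  a line in points on the two sides of \<open>1\<close>, and their product is a translation.
\<close>

lemma exists_translation: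
  obtains t where "t \<in> carrier G" "Sep \<one> t (inv t)"
proof -
  obtain x y where xy: "x \<in> carrier G" "y \<in> carrier G" "Sep \<one> x y" using Sep_one_ex by blast
  show thesis
  proof (cases "Sep \<one> x (inv x) \<or> Sep \<one> y (inv y)")
    case True
    then show ?thesis using that xy by blast
  next
    case False
    have pos: "0 < D \<one> x" "0 < D \<one> y" using Sep_pos Sep_pos' xy by auto
    have 1: "Sep \<one> (inv x) y" using Sep_cotrans[of \<one> x y "inv x"] xy pos False by (auto simp: D_inv)
    have 2: "Sep \<one> (inv y) x"
      using Sep_cotrans[of \<one> y x "inv y"] xy pos False Sep_sym[of \<one> x y] by (auto simp: D_inv)
    have "Sep x \<one> (x \<otimes> y)" using Sep_left[of x \<one> "inv x" y] 1 xy by simp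
    then have t: "Sep x \<one> (x \<otimes> y)" "Sep \<one> y (x \<otimes> y)"
      using Sep_chain[of \<one> y x "x \<otimes> y"] xy Sep_sym[of \<one> x y] by auto
    have "Sep (inv y) \<one> (inv y \<otimes> inv x)"
      using Sep_left[of "inv y" \<one> y "inv x"] 1 xy Sep_sym[of \<one> "inv x" y] by simp
    then have t': "Sep \<one> x (inv y \<otimes> inv x)"
      using Sep_chain[of \<one> x "inv y" "inv y \<otimes> inv x"] xy 2 Sep_sym[of \<one> "inv y" x] by auto
    have "\<not> Sep \<one> x (x \<otimes> y)" using Sep_swap[of \<one> x "x \<otimes> y"] t xy by auto
    moreover have "0 < D \<one> (x \<otimes> y)" using Sep_pos'[of \<one> y "x \<otimes> y"] t xy by auto
    ultimately have "Sep \<one> (x \<otimes> y) (inv y \<otimes> inv x)"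
      using Sep_cotrans[of \<one> x "inv y \<otimes> inv x" "x \<otimes> y"] t' xy by auto
    then show ?thesis using that[of "x \<otimes> y"] xy by (simp add: inv_mult_group)
  qed
qed

definition linear_betweenness :: bool where
  "linear_betweenness \<longleftrightarrow> (\<forall>x\<in>carrier G. \<forall>y\<in>carrier G. \<forall>z\<in>carrier G.
     0 < D x y \<longrightarrow> 0 < D y z \<longrightarrow> 0 < D x z \<longrightarrow> Sep x y z \<or> Sep y x z \<or> Sep z x y)"

text \<open>
  If \<open>q\<close> is not near \<open>1\<close>, then \<open>1\<close> separates \<open>q\<close> from each of \<open>t\<close>, \<open>t\<^sup>-\<^sup>1\<close> that is not near
  \<open>q\<close>. Three points pairwise separated by \<open>1\<close> are not on a line, so \<open>q\<close> is near one of the two.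
\<close>

lemma line_near_translation:
  assumes line: linear_betweenness
    and t: "t \<in> carrier G" "Sep \<one> t (inv t)" and q: "q \<in> carrier G" "D \<one> q < D \<one> t"
  shows "D \<one> q \<le> D \<one> t / 2 \<or> D q t \<le> D \<one> t / 2 \<or> D q (inv t) \<le> D \<one> t / 2"
proof (rule ccontr)
  assume n: "\<not> ?thesis"
  have tpos: "0 < D \<one> t" using Sep_pos[of \<one> t "inv t"] t by simp
  have near: "Sep \<one> q s" if s: "s \<in> carrier G" "D \<one> s = D \<one> t" "D q s > D \<one> t / 2" for s
  proof -
    have "Sep \<one> q s \<or> Sep q \<one> s \<or> Sep s \<one> q"
      using line s q n tpos by (auto simp: linear_betweenness_def)
    moreover have "\<not> Sep q \<one> s" using Sep_dist[of q \<one> s] s q n by force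
    moreover have "\<not> Sep s \<one> q"
      using Sep_dist[of s \<one> q] D_nonneg[of s q] s q by force
    ultimately show ?thesis by blast
  qed
  have 1: "D q t = D \<one> q + D \<one> t"
    using near[of t] Sep_dist[of \<one> q t] n t q by (auto simp: D_commute)
  have 2: "D q (inv t) = D \<one> q + D \<one> t"
    using near[of "inv t"] Sep_dist[of \<one> q "inv t"] n t q by (auto simp: D_commute D_inv)
  have 3: "D t (inv t) = 2 * D \<one> t"
    using Sep_dist[of \<one> t "inv t"] t D_commute[of t \<one>] by (simp add: D_inv)
  have q0: "0 \<le> D \<one> q" "D t q = D q t" using D_nonneg D_commute q t by auto
  have "Sep q t (inv t) \<or> Sep t q (inv t) \<or> Sep (inv t) q t"
    using line t q 1 2 3 tpos n by (auto simp: linear_betweenness_def)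
  moreover have "\<not> Sep q t (inv t)" using Sep_dist[of q t "inv t"] t q 1 2 3 q0 n tpos by force
  moreover have "\<not> Sep t q (inv t)" using Sep_dist[of t q "inv t"] t q 1 2 3 q0 n tpos by force
  moreover have "\<not> Sep (inv t) q t"
    using Sep_dist[of "inv t" q t] D_commute[of "inv t" t] t q 1 2 3 q0 n tpos by force
  ultimately show False by blast
qed

subsection \<open>Three points in general position\<close>

text \<open>
  The element \<open>b\<close> only serves to name the component of the complement of \<open>1\<close> in which it lies. This
  component is ascending if no element and its inverse both lie outside it.
\<close>

definition ascending :: "'a \<Rightarrow> bool" where
  "ascending b \<longleftrightarrow> b \<in> carrier G \<and> 0 < D \<one> b \<and> (\<forall>k\<in>carrier G. \<not> (Sep \<one> b k \<and> Sep \<one> b (inv k)))"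

text \<open>
  Let \<open>X i\<close> be the set of points that \<open>v i\<close> separates from the other two vertices. As the component of
  the other vertices is not ascending at \<open>v i\<close>, there is \<open>k i\<close> such that both \<open>v i k\<^sup>\<plusminus>\<^sup>1\<close> are in
  \<open>X i\<close>. The conjugate \<open>g i\<close> of \<open>k i\<close> by \<open>v i\<close> and its inverse then map the other two sets into
  \<open>X i\<close>, which is table tennis for a free product of three groups. In it \<open>g 0 g 1\<close> and the conjugate
  \<open>f\<close> of \<open>g 0\<close> by \<open>g 2\<close> are as needed for \<open>table_tennis_no_law\<close>. Two points would not suffice: a
  free product of two groups may be infinite dihedral.
\<close>

lemma no_law_of_triple:
  fixes v :: "nat \<Rightarrow> 'a"
  assumes v: "\<And>i. i < 3 \<Longrightarrow> v i \<in> carrier G"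
    and dist: "\<And>i j. i < 3 \<Longrightarrow> j < 3 \<Longrightarrow> i \<noteq> j \<Longrightarrow> 0 < D (v i) (v j)"
    and nsep: "\<And>i j k. i < 3 \<Longrightarrow> j < 3 \<Longrightarrow> k < 3 \<Longrightarrow> j \<noteq> i \<Longrightarrow> k \<noteq> i \<Longrightarrow> j \<noteq> k \<Longrightarrow> \<not> Sep (v i) (v j) (v k)"
    and na: "\<And>b. \<not> ascending b"
    and law: "is_law n w"
  shows "\<not> satisfies_law G n w"
proof -
  have "\<exists>k\<in>carrier G. \<forall>j<3. j \<noteq> i \<longrightarrow> Sep \<one> (inv (v i) \<otimes> v j) k \<and> Sep \<one> (inv (v i) \<otimes> v j) (inv k)"
    if i: "i < 3" for i :: nat
  proof -
    define j :: nat where "j = (if i = 0 then 1 else 0)"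
    have j: "j < 3" "j \<noteq> i" by (auto simp: j_def)
    have D1: "D \<one> (inv (v i) \<otimes> v l) = D (v i) (v l)" if "l < 3" for l
      using D_left[of "v i" \<one> "inv (v i) \<otimes> v l"] v that i by simp
    have "\<not> ascending (inv (v i) \<otimes> v j)" by (rule na)
    then obtain k where k: "k \<in> carrier G" "Sep \<one> (inv (v i) \<otimes> v j) k" "Sep \<one> (inv (v i) \<otimes> v j) (inv k)"
      using D1[of j] dist[of i j] i j v by (auto simp: ascending_def)
    have "Sep \<one> (inv (v i) \<otimes> v l) x"
      if l: "l < 3" "l \<noteq> i" and x: "x \<in> carrier G" "Sep \<one> (inv (v i) \<otimes> v j) x" for l x
    proof (cases "l = j")
      case False
      have "\<not> Sep \<one> (inv (v i) \<otimes> v j) (inv (v i) \<otimes> v l)"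
        using Sep_left[of "v i" \<one> "inv (v i) \<otimes> v j" "inv (v i) \<otimes> v l"] nsep[of i j l] i j l v False by auto
      then show ?thesis
        using Sep_cotrans[of \<one> "inv (v i) \<otimes> v j" x "inv (v i) \<otimes> v l"] x l D1[of l] dist[of i l] i j v by auto
    qed (use x in simp)
    then show ?thesis using k by (intro bexI[of _ k]) auto
  qed
  then obtain k where k: "\<And>i. i < 3 \<Longrightarrow> k i \<in> carrier G"
    "\<And>i j. i < 3 \<Longrightarrow> j < 3 \<Longrightarrow> j \<noteq> i \<Longrightarrow> Sep \<one> (inv (v i) \<otimes> v j) (k i)"
    "\<And>i j. i < 3 \<Longrightarrow> j < 3 \<Longrightarrow> j \<noteq> i \<Longrightarrow> Sep \<one> (inv (v i) \<otimes> v j) (inv (k i))"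
    by metis
  define X where "X i = {x \<in> carrier G. \<forall>j<3. j \<noteq> i \<longrightarrow> Sep (v i) (v j) x}" for i :: nat
  define g where "g i = v i \<otimes> k i \<otimes> inv (v i)" for i
  have gc: "g i \<in> carrier G" if "i < 3" for i using that v k by (simp add: g_def)
  have tt: "v i \<otimes> h \<otimes> inv (v i) \<otimes> x \<in> X i"
    if i: "i < 3" and j: "j < 3" "j \<noteq> i" and x: "x \<in> X j" and h: "h \<in> carrier G"
      "\<And>l. l < 3 \<Longrightarrow> l \<noteq> i \<Longrightarrow> Sep \<one> (inv (v i) \<otimes> v l) h \<and> Sep \<one> (inv (v i) \<otimes> v l) (inv h)" for i j x h
  proof -
    have xc: "x \<in> carrier G" and sx: "Sep (v j) (v i) x" using x i j by (auto simp: X_def)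
    have "Sep (inv (v i) \<otimes> v j) \<one> (inv (v i) \<otimes> x)"
      using Sep_left[of "v i" "inv (v i) \<otimes> v j" \<one> "inv (v i) \<otimes> x"] sx xc i j v by simp
    moreover have "Sep \<one> (inv h) (inv (v i) \<otimes> v j)"
      using h(2)[OF j] Sep_sym v i j h(1) by auto
    ultimately have "Sep \<one> (inv h) (inv (v i) \<otimes> x)"
      using Sep_chain[of \<one> "inv h" "inv (v i) \<otimes> v j" "inv (v i) \<otimes> x"] v i j h(1) xc by auto
    then have 1: "Sep h \<one> (h \<otimes> (inv (v i) \<otimes> x))"
      using Sep_left[of h \<one> "inv h" "inv (v i) \<otimes> x"] h(1) v i xc by simp
    have "Sep (v i) (v l) (v i \<otimes> (h \<otimes> (inv (v i) \<otimes> x)))" if l: "l < 3" "l \<noteq> i" for l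
    proof -
      have "Sep \<one> (inv (v i) \<otimes> v l) (h \<otimes> (inv (v i) \<otimes> x))"
        using Sep_chain[of \<one> "inv (v i) \<otimes> v l" h "h \<otimes> (inv (v i) \<otimes> x)"] 1 h(2)[OF l] v i l h(1) xc by auto
      then show ?thesis
        using Sep_left[of "v i" \<one> "inv (v i) \<otimes> v l" "h \<otimes> (inv (v i) \<otimes> x)"] v i l h(1) xc by simp
    qed
    then show ?thesis using v i h(1) xc by (simp add: X_def m_assoc)
  qed
  have gX: "g i \<otimes> x \<in> X i" if "i < 3" "j < 3" "j \<noteq> i" "x \<in> X j" for i j x
    unfolding g_def using tt[of i j x "k i"] that k by auto
  have giX: "inv (g i) \<otimes> x \<in> X i" if "i < 3" "j < 3" "j \<noteq> i" "x \<in> X j" for i j x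
  proof -
    have "inv (g i) = v i \<otimes> inv (k i) \<otimes> inv (v i)"
      using that v k by (simp add: g_def inv_mult_group m_assoc)
    then show ?thesis using tt[of i j x "inv (k i)"] that k by auto
  qed
  have Xc: "X i \<subseteq> carrier G" for i by (auto simp: X_def)
  have disj: "X i \<inter> X j = {}" if "i < 3" "j < 3" "i \<noteq> j" for i j
    using that Sep_swap[of "v i" "v j"] v unfolding X_def by blast
  have ne: "v 2 \<otimes> k 2 \<in> X 2"
  proof -
    have "Sep (v 2) (v j) (v 2 \<otimes> k 2)" if "j < 3" "j \<noteq> 2" for j
      using Sep_left[of "v 2" \<one> "inv (v 2) \<otimes> v j" "k 2"] that v k by simp
    then show ?thesis using v k by (simp add: X_def)
  qed
  define a where "a = g 0 \<otimes> g 1"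
  define f where "f = g 2 \<otimes> g 0 \<otimes> inv (g 2)"
  have [simp]: "g 0 \<in> carrier G" "g 1 \<in> carrier G" "g 2 \<in> carrier G" "g (Suc 0) \<in> carrier G" using gc by auto
  have ac: "a \<in> carrier G" and fc: "f \<in> carrier G" by (simp_all add: a_def f_def)
  have xc: "x \<in> carrier G" if "x \<in> X i" for x i using that Xc by blast
  have "a \<otimes> x \<in> X 0" if "x \<in> X 2 \<union> X 0" for x
    using that gX[of 0 1 "g 1 \<otimes> x"] gX[of 1 2 x] gX[of 1 0 x] xc by (auto simp: a_def m_assoc)
  then have apos: "a [^] (Suc m) \<otimes> x \<in> X 0" if "x \<in> X 2" for m x
  proof (induction m)
    case 0 then show ?case using that ac by simp
  next
    case (Suc m)
    have "a [^] Suc (Suc m) \<otimes> x = a \<otimes> (a [^] Suc m \<otimes> x)"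
      using ac xc[OF that] by (metis m_assoc nat_pow_Suc2 nat_pow_closed)
    then show ?case using Suc by auto
  qed
  have ia: "inv a = inv (g 1) \<otimes> inv (g 0)" by (simp add: a_def inv_mult_group)
  have "inv a \<otimes> x \<in> X 1" if "x \<in> X 2 \<union> X 1" for x
    unfolding ia using that giX[of 1 0 "inv (g 0) \<otimes> x"] giX[of 0 2 x] giX[of 0 1 x] xc by (auto simp: m_assoc)
  then have aneg: "inv a [^] (Suc m) \<otimes> x \<in> X 1" if "x \<in> X 2" for m x
  proof (induction m)
    case 0 then show ?case using that ac by simp
  next
    case (Suc m)
    have "inv a [^] Suc (Suc m) \<otimes> x = inv a \<otimes> (inv a [^] Suc m \<otimes> x)"
      using ac xc[OF that] by (metis m_assoc nat_pow_Suc2 nat_pow_closed inv_closed)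
    then show ?case using Suc by auto
  qed
  have apow: "a [^] m \<otimes> y \<in> X 0 \<union> X 1" if "m \<noteq> 0" "y \<in> X 2" for m :: int and y
  proof (cases "m > 0")
    case True
    then have "m = int (Suc (nat m - 1))" by simp
    then obtain r where "m = int (Suc r)" by blast
    then show ?thesis using apos[OF that(2)] by (metis UnI1 int_pow_int)
  next
    case False
    then have "m = - int (Suc (nat (- m) - 1))" using that(1) by simp
    then obtain r where "m = - int (Suc r)" by blast
    then show ?thesis using aneg[OF that(2)] ac by (metis UnI2 int_pow_neg_int nat_pow_inv)
  qed
  have fi: "inv f = g 2 \<otimes> inv (g 0) \<otimes> inv (g 2)" by (simp add: f_def inv_mult_group m_assoc)
  have fX: "f \<otimes> z \<in> X 2" "inv f \<otimes> z \<in> X 2" if z: "z \<in> X 0 \<union> X 1" for z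
  proof -
    have 1: "inv (g 2) \<otimes> z \<in> X 2" using z giX[of 2 0 z] giX[of 2 1 z] by auto
    show "f \<otimes> z \<in> X 2" using gX[OF _ _ _ gX[OF _ _ _ 1, of 0], of 2] z xc by (auto simp: f_def m_assoc)
    show "inv f \<otimes> z \<in> X 2" unfolding fi
      using gX[OF _ _ _ giX[OF _ _ _ 1, of 0], of 2] z xc by (auto simp: m_assoc)
  qed
  show ?thesis
    by (rule table_tennis_no_law[OF law ac fc Xc ne _ apow fX])
      (use disj[of 2 0] disj[of 2 1] in auto)
qed

subsection \<open>The order given by an ascending direction\<close>

text \<open>
  The translate \<open>y b\<close> of \<open>b\<close> lies in the ascending component at \<open>y\<close>; the points below \<open>y\<close> are those
  in the other components.
\<close>

definition below :: "'a \<Rightarrow> 'a \<Rightarrow> 'a \<Rightarrow> bool" where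
  "below b x y \<longleftrightarrow> Sep y (y \<otimes> b) x"

context
  fixes b assumes asc: "ascending b"
begin

lemma b_closed [simp]: "b \<in> carrier G" and b_pos: "0 < D \<one> b"
  using asc by (auto simp: ascending_def)

lemma below_left [simp]:
  "g \<in> carrier G \<Longrightarrow> x \<in> carrier G \<Longrightarrow> y \<in> carrier G \<Longrightarrow> below b (g \<otimes> x) (g \<otimes> y) \<longleftrightarrow> below b x y"
  by (simp add: below_def m_assoc)

lemma below_pos:
  "x \<in> carrier G \<Longrightarrow> y \<in> carrier G \<Longrightarrow> below b x y \<Longrightarrow> 0 < D x y"
  using Sep_pos'[of y "y \<otimes> b" x] D_commute[of x y] by (simp add: below_def)

text \<open>
  If each of \<open>x\<close> and \<open>y\<close> were below the other, then \<open>x\<^sup>-\<^sup>1y\<close> and its inverse would both lie outside the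
  ascending component at \<open>1\<close>.
\<close>

lemma below_asym:
  assumes "x \<in> carrier G" "y \<in> carrier G" "below b x y"
  shows "\<not> below b y x"
proof
  assume yx: "below b y x"
  have "below b (inv x \<otimes> y) (inv x \<otimes> x)" "below b (inv y \<otimes> x) (inv y \<otimes> y)"
    using yx assms by (simp_all only: below_left inv_closed)
  then have "Sep \<one> b (inv x \<otimes> y)" "Sep \<one> b (inv (inv x \<otimes> y))"
    using assms by (simp_all add: below_def inv_mult_group)
  then show False using asc assms by (auto simp: ascending_def)
qed

lemma not_below_Sep:
  assumes "x \<in> carrier G" "y \<in> carrier G" "z \<in> carrier G" "below b x y" "\<not> below b z y" "0 < D y z"
  shows "Sep y z x"
  using assms Sep_cotrans[of y "y \<otimes> b" x z] by (auto simp: below_def)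

lemma below_chain_Sep:
  assumes "x \<in> carrier G" "y \<in> carrier G" "z \<in> carrier G" "below b x y" "below b y z"
  shows "Sep y z x"
  using not_below_Sep[of x y z] below_asym[of y z] below_pos[of y z] assms by auto

lemma below_trans:
  assumes "x \<in> carrier G" "y \<in> carrier G" "z \<in> carrier G" "below b x y" "below b y z"
  shows "below b x z"
  using below_chain_Sep[OF assms] Sep_chain[of z "z \<otimes> b" y x] assms by (simp add: below_def)

lemma below_dist:
  assumes "x \<in> carrier G" "y \<in> carrier G" "z \<in> carrier G" "below b x y" "below b y z"
  shows "D x z = D x y + D y z"
  using below_chain_Sep[OF assms] Sep_dist[of y z x] assms D_commute by auto

text \<open>
  Two incomparable points above \<open>x\<close> would each separate the other from \<open>x\<close>.
\<close>

lemma below_total: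
  assumes c: "x \<in> carrier G" "y \<in> carrier G" "z \<in> carrier G" and "below b x y" "below b x z" "0 < D y z"
  shows "below b y z \<or> below b z y"
proof (rule ccontr)
  assume n: "\<not> ?thesis"
  then have "Sep y z x" "Sep z y x"
    using not_below_Sep[of x y z] not_below_Sep[of x z y] assms D_commute[of y z] by auto
  then show False using Sep_swap[of y z x] c by blast
qed

lemma below_abs_dist:
  assumes c: "x \<in> carrier G" "y \<in> carrier G" "z \<in> carrier G" and xy: "below b x y" "below b x z"
  shows "D y z = \<bar>D x y - D x z\<bar>"
proof (cases "0 < D y z")
  case True
  then show ?thesis
    using below_total[OF assms] below_dist[of x y z] below_dist[of x z y] D_nonneg[of y z]
      D_commute[of y z] assms by auto
next
  case False
  then have "D y z = 0" using D_nonneg[of y z] c by simp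
  then show ?thesis using D_triangle[of x y z] D_triangle[of x z y] c D_commute[of y z] by simp
qed

text \<open>
  A point that is not below \<open>y\<close> can be reached from \<open>x\<close> only through \<open>y\<close>.
\<close>

lemma below_near:
  assumes c: "x \<in> carrier G" "y \<in> carrier G" "z \<in> carrier G" and xy: "below b x y" and l: "D x z < D x y"
  shows "below b z y"
proof (rule ccontr)
  assume n: "\<not> ?thesis"
  have "0 < D y z" using D_triangle[of x z y] D_commute[of y z] l c by simp
  then have "D z x = D z y + D y x" using not_below_Sep[of x y z] Sep_dist[of y z x] assms n by simp
  then show False using l D_nonneg[of z y] D_commute[of z x] D_commute[of y x] c by simp
qed

lemma exists_high:
  obtains y where "y \<in> carrier G" "below b \<one> y" "R < D \<one> y"
proof -
  obtain x y where xy: "x \<in> carrier G" "y \<in> carrier G" "Sep \<one> x y" using Sep_one_ex by blast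
  then have "Sep \<one> x b \<or> Sep \<one> b y" using Sep_cotrans[of \<one> x y b] b_pos by auto
  then obtain u where u: "u \<in> carrier G" "Sep \<one> b u" using xy Sep_sym[of \<one> x b] by auto
  define v where "v = inv u"
  have v: "v \<in> carrier G" using u by (simp add: v_def)
  have "below b u \<one>" using u by (simp add: below_def)
  then have "below b (v \<otimes> u) (v \<otimes> \<one>)" using u v below_left by blast
  then have v1: "below b \<one> v" using u by (simp add: v_def)
  have pos: "0 < D \<one> v" using below_pos v v1 by simp
  have pw: "below b \<one> (v [^] Suc m) \<and> D \<one> (v [^] Suc m) = real (Suc m) * D \<one> v" for m
  proof (induction m)
    case 0 then show ?case using v v1 by simp
  next
    case (Suc m)
    let ?y = "v [^] Suc m"
    have yc: "?y \<in> carrier G" using v by simp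
    have 1: "below b ?y (?y \<otimes> v)" using below_left[of ?y \<one> v] v v1 yc by simp
    have "D ?y (?y \<otimes> v) = D \<one> v" using D_left[of ?y \<one> v] v yc by simp
    then show ?case
      using below_trans[of \<one> ?y "?y \<otimes> v"] below_dist[of \<one> ?y "?y \<otimes> v"] 1 Suc yc v
      by (simp add: algebra_simps)
  qed
  obtain m where "R < real m * D \<one> v" using pos reals_Archimedean3 by blast
  also have "\<dots> \<le> D \<one> (v [^] Suc m)" using pw[of m] pos by simp
  finally show thesis using that[of "v [^] Suc m"] pw[of m] v by simp
qed

text \<open>
  Descending from \<open>p\<close> moves away from every point that is incomparable with \<open>p\<close>.
\<close>

lemma incomparable_below:
  assumes c: "p \<in> carrier G" "q \<in> carrier G" "x \<in> carrier G"
    and pos: "0 < D p q" and n: "\<not> below b p q" "\<not> below b q p"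
    and x: "below b x p \<or> x = p"
  shows "D p q \<le> D x q" "\<not> below b x q" "\<not> below b q x"
proof -
  consider "below b x p" | "x = p" using x by blast
  then have "D p q \<le> D x q \<and> \<not> below b x q \<and> \<not> below b q x"
  proof cases
    case 1
    have "Sep p q x" using not_below_Sep[of x p q] 1 n pos c by auto
    then have "D q x = D q p + D p x" using Sep_dist c by simp
    then have "D p q \<le> D x q" using D_nonneg[of p x] D_commute[of q x] D_commute[of q p] c by simp
    moreover have "\<not> below b q x" using below_trans[of q x p] 1 n c by auto
    moreover have "\<not> below b x q" using below_total[of x p q] 1 n c pos by auto
    ultimately show ?thesis by blast
  qed (use n in simp)
  then show "D p q \<le> D x q" "\<not> below b x q" "\<not> below b q x" by auto
qed

lemma incomparable_cones_apart:
  assumes c: "p \<in> carrier G" "q \<in> carrier G" "x \<in> carrier G" "y \<in> carrier G"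
    and pos: "0 < D p q" and n: "\<not> below b p q" "\<not> below b q p"
    and x: "below b x p \<or> x = p" and y: "below b y q \<or> y = q"
  shows "D p q \<le> D x y"
proof -
  note 1 = incomparable_below[OF c(1,2,3) pos n x]
  have "0 < D q x" using 1(1) pos D_commute[of x q] c by simp
  from incomparable_below(1)[OF c(2,3,4) this 1(3,2) y] have "D q x \<le> D y x" .
  then show ?thesis using 1(1) D_commute[of q x] D_commute[of y x] c by simp
qed

text \<open>
  Choose \<open>v\<close> above both \<open>1\<close> and \<open>h\<close>. Seen from \<open>v\<close>, these are two incomparable points below, so the
  elements \<open>v\<^sup>-\<^sup>1\<close> and \<open>v\<^sup>-\<^sup>1h\<close> descend from \<open>1\<close> into disjoint branches. Their positive words branch at
  the first letter where they differ and never come close again.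
\<close>

lemma separated_words:
  assumes h: "h \<in> carrier G" "0 < D \<one> h" "\<not> below b \<one> h" "\<not> below b h \<one>"
  obtains \<delta> :: "bool \<Rightarrow> 'a" where "\<And>c. \<delta> c \<in> carrier G"
    "\<And>s s'. length s = length s' \<Longrightarrow> s \<noteq> s' \<Longrightarrow>
       D \<one> h \<le> D (foldr (\<otimes>) (map \<delta> s) \<one>) (foldr (\<otimes>) (map \<delta> s') \<one>)"
proof -
  obtain v where v: "v \<in> carrier G" "below b \<one> v" "D \<one> h < D \<one> v" using exists_high .
  have hv: "below b h v" using below_near[of \<one> v h] v h by simp
  define \<delta> where "\<delta> c = (if c then inv v else inv v \<otimes> h)" for c
  have \<delta>: "\<delta> c \<in> carrier G" for c using v h by (simp add: \<delta>_def)
  have "below b (inv v \<otimes> \<one>) (inv v \<otimes> v)" "below b (inv v \<otimes> h) (inv v \<otimes> v)"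
    using v h hv below_left by blast+
  then have low: "below b (\<delta> c) \<one>" for c using v by (simp add: \<delta>_def)
  have inc: "D (\<delta> c) (\<delta> (\<not> c)) = D \<one> h \<and> \<not> below b (\<delta> c) (\<delta> (\<not> c))" for c
    using D_left[of "inv v" \<one> h] D_left[of "inv v" h \<one>] below_left[of "inv v" \<one> h]
      below_left[of "inv v" h \<one>] v h D_commute[of h \<one>] by (cases c) (simp_all add: \<delta>_def)
  let ?W = "\<lambda>s. foldr (\<otimes>) (map \<delta> s) \<one>"
  have W: "?W s \<in> carrier G" for s by (rule foldr_mult_closed) (auto simp: \<delta>)
  have lowW: "below b (?W s) \<one> \<or> ?W s = \<one>" for s
  proof (induction s)
    case (Cons c s)
    have "below b (\<delta> c \<otimes> ?W s) \<one>"
    proof (cases "?W s = \<one>")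
      case False
      then have "below b (\<delta> c \<otimes> ?W s) (\<delta> c \<otimes> \<one>)" using Cons \<delta> W by (simp only: below_left one_closed) simp
      then show ?thesis using below_trans[of "\<delta> c \<otimes> ?W s" "\<delta> c" \<one>] low \<delta> W by simp
    qed (use low \<delta> in simp)
    then show ?case by simp
  qed simp
  have lowD: "below b (\<delta> c \<otimes> ?W s) (\<delta> c) \<or> \<delta> c \<otimes> ?W s = \<delta> c" for c s
    using lowW[of s] below_left[of "\<delta> c" "?W s" \<one>] \<delta> W by auto
  have "D \<one> h \<le> D (?W s) (?W s')" if "length s = length s'" "s \<noteq> s'" for s s'
    using that
  proof (induction s s' rule: list_induct2)
    case (Cons c s c' s')
    show ?case
    proof (cases "c = c'")
      case True
      then show ?thesis using Cons \<delta> W by simp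
    next
      case False
      then have c': "c' = (\<not> c)" by auto
      have "D (\<delta> c) (\<delta> (\<not> c)) \<le> D (\<delta> c \<otimes> ?W s) (\<delta> (\<not> c) \<otimes> ?W s')"
        using incomparable_cones_apart[of "\<delta> c" "\<delta> (\<not> c)" "\<delta> c \<otimes> ?W s" "\<delta> (\<not> c) \<otimes> ?W s'"]
          inc[of c] inc[of "\<not> c"] lowD \<delta> W h by simp
      then show ?thesis using inc[of c] c' by simp
    qed
  qed simp
  then show thesis using that \<delta> by blast
qed

text \<open>
  For \<open>g\<close> in the ball of radius \<open>R\<close>, both \<open>y\<close> and \<open>gy\<close> are above \<open>g\<close>, hence comparable, at distance at
  most \<open>R\<close>. So the conjugate \<open>e\<close> of \<open>g\<close> by \<open>y\<close> or its inverse is above \<open>1\<close>, up to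
  distance \<open>0\<close>. On the chain of these points distances are differences of distances to \<open>1\<close>, and the pigeonhole principle applies.
\<close>

lemma conjugate_crowding:
  assumes R: "0 \<le> R" and \<eta>: "0 < \<eta>"
    and y: "y \<in> carrier G" "below b \<one> y" "R < D \<one> y"
    and g: "\<And>j. j < M \<Longrightarrow> g j \<in> carrier G" "\<And>j. j < M \<Longrightarrow> D \<one> (g j) \<le> R"
    and M: "2 * (nat \<lfloor>R / \<eta>\<rfloor> + 1) < M"
  shows "\<exists>j<M. \<exists>k<M. j \<noteq> k \<and>
     (D (inv y \<otimes> g j \<otimes> y) (inv y \<otimes> g k \<otimes> y) < \<eta> \<or>
      D (inv (inv y \<otimes> g j \<otimes> y)) (inv (inv y \<otimes> g k \<otimes> y)) < \<eta>)"
proof -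
  define e where "e j = inv y \<otimes> g j \<otimes> y" for j
  define up where "up x \<longleftrightarrow> below b \<one> x \<or> D \<one> x = 0" for x
  have ec: "e j \<in> carrier G" if "j < M" for j using that g y by (simp add: e_def)
  have up_dist: "D x x' = \<bar>D \<one> x - D \<one> x'\<bar>"
    if c: "x \<in> carrier G" "x' \<in> carrier G" and u: "up x" "up x'" for x x'
  proof (cases "below b \<one> x \<and> below b \<one> x'")
    case True
    then show ?thesis using below_abs_dist[of \<one> x x'] c by simp
  next
    case False
    then have "D \<one> x = 0 \<or> D \<one> x' = 0" using u by (auto simp: up_def)
    then show ?thesis
      using D_triangle[of \<one> x x'] D_triangle[of \<one> x' x] D_triangle[of x \<one> x'] D_nonneg[of x x']
        D_commute[of x x'] D_commute[of x \<one>] D_nonneg[of \<one> x] D_nonneg[of \<one> x'] c by auto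
  qed
  have e: "D \<one> (e j) \<le> R \<and> (up (e j) \<or> up (inv (e j)))" if j: "j < M" for j
  proof -
    have gc: "g j \<in> carrier G" "D \<one> (g j) \<le> R" using g j by auto
    have 1: "below b (g j) y" using below_near[of \<one> y "g j"] y gc by simp
    have 2: "below b (g j) (g j \<otimes> y)" using below_left[of "g j" \<one> y] y gc by simp
    have eD: "D \<one> (e j) = D y (g j \<otimes> y)"
      using D_left[of y \<one> "e j"] ec[OF j] y gc by (simp add: e_def m_assoc)
    also have "\<dots> = \<bar>D (g j) y - D \<one> y\<bar>"
      using below_abs_dist[of "g j" y "g j \<otimes> y"] 1 2 y gc D_left[of "g j" \<one> y] by simp
    also have "\<dots> \<le> D \<one> (g j)"
      using D_triangle[of "g j" \<one> y] D_triangle[of \<one> "g j" y] D_commute[of "g j" \<one>] y gc by simp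
    finally have le: "D \<one> (e j) \<le> R" using gc by simp
    have "up (e j) \<or> up (inv (e j))"
    proof (cases "0 < D y (g j \<otimes> y)")
      case True
      then consider "below b y (g j \<otimes> y)" | "below b (g j \<otimes> y) y"
        using below_total[of "g j" y "g j \<otimes> y"] 1 2 y gc by auto
      then show ?thesis
      proof cases
        case 1
        then have "below b (inv y \<otimes> y) (inv y \<otimes> (g j \<otimes> y))" using below_left y gc by blast
        then show ?thesis using y gc by (simp add: up_def e_def m_assoc)
      next
        case 2
        have "inv (e j) \<otimes> (inv y \<otimes> (g j \<otimes> y)) = \<one>" 
          using y gc l_inv[OF ec[OF j]] by (simp add: e_def m_assoc)
        moreover have "inv (e j) \<otimes> (inv y \<otimes> y) = inv (e j)" using y ec[OF j] by simp
        moreover have "below b (inv y \<otimes> (g j \<otimes> y)) (inv y \<otimes> y)" using below_left y gc 2 by blast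
        then have "below b (inv (e j) \<otimes> (inv y \<otimes> (g j \<otimes> y))) (inv (e j) \<otimes> (inv y \<otimes> y))"
          using below_left y gc ec[OF j] by (meson inv_closed m_closed)
        ultimately show ?thesis by (simp add: up_def)
      qed
    next
      case False
      then have "D \<one> (e j) = 0" using eD D_nonneg[of \<one> "e j"] ec[OF j] by simp
      then show ?thesis by (simp add: up_def)
    qed
    then show ?thesis using le by blast
  qed
  define c where "c j = (up (e j), nat \<lfloor>D \<one> (e j) / \<eta>\<rfloor>)" for j
  have "c ` {..<M} \<subseteq> UNIV \<times> {..nat \<lfloor>R / \<eta>\<rfloor>}"
    using e \<eta> by (auto simp: c_def intro!: nat_mono floor_mono divide_right_mono)
  then have "card (c ` {..<M}) \<le> card ((UNIV :: bool set) \<times> {..nat \<lfloor>R / \<eta>\<rfloor>})"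
    by (intro card_mono) auto
  then have "card (c ` {..<M}) < card {..<M}" using M by (simp add: card_cartesian_product)
  then have "\<not> inj_on c {..<M}" by (metis card_image less_irrefl)
  then obtain j k where jk: "j < M" "k < M" "j \<noteq> k" "c j = c k" by (auto simp: inj_on_def)
  have nn: "0 \<le> D \<one> (e j)" "0 \<le> D \<one> (e k)" using D_nonneg ec jk by auto
  have "\<lfloor>D \<one> (e j) / \<eta>\<rfloor> = \<lfloor>D \<one> (e k) / \<eta>\<rfloor>"
    using jk(4) nn \<eta> by (simp add: c_def eq_nat_nat_iff)
  then have "\<bar>D \<one> (e j) / \<eta> - D \<one> (e k) / \<eta>\<bar> < 1" by linarith
  then have close: "\<bar>D \<one> (e j) - D \<one> (e k)\<bar> < \<eta>"
    using \<eta> by (simp add: abs_less_iff field_simps)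
  have "D (e j) (e k) < \<eta> \<or> D (inv (e j)) (inv (e k)) < \<eta>"
  proof (cases "up (e j)")
    case True
    then have "up (e k)" using jk(4) by (simp add: c_def)
    then show ?thesis using up_dist[of "e j" "e k"] True close ec jk by simp
  next
    case False
    then have "\<not> up (e k)" using jk(4) by (simp add: c_def)
    then have "up (inv (e j))" "up (inv (e k))" using e jk False by auto
    then show ?thesis using up_dist[of "inv (e j)" "inv (e k)"] close ec jk by (simp add: D_inv)
  qed
  then show ?thesis using jk unfolding e_def by blast
qed

lemma exists_incomparable:
  assumes n: "\<not> linear_betweenness"
  obtains h where "h \<in> carrier G" "0 < D \<one> h" "\<not> below b \<one> h" "\<not> below b h \<one>"
proof -
  obtain x y z where c: "x \<in> carrier G" "y \<in> carrier G" "z \<in> carrier G"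
    and pos: "0 < D x y" "0 < D y z" "0 < D x z"
    and ns: "\<not> Sep x y z" "\<not> Sep y x z" "\<not> Sep z x y"
    using n by (auto simp: linear_betweenness_def)
  have ns': "\<not> Sep x z y" "\<not> Sep y z x" "\<not> Sep z y x" using ns Sep_sym c by blast+
  have "\<not> ((below b x y \<or> below b y x) \<and> (below b y z \<or> below b z y) \<and> (below b x z \<or> below b z x))"
    using below_chain_Sep below_asym ns ns' c by metis
  then obtain p q where pq: "p \<in> carrier G" "q \<in> carrier G" "0 < D p q" "\<not> below b p q" "\<not> below b q p"
    using c pos by blast
  show thesis
  proof (rule that[of "inv p \<otimes> q"])
    show "0 < D \<one> (inv p \<otimes> q)" using D_left[of p \<one> "inv p \<otimes> q"] pq by simp
    show "\<not> below b \<one> (inv p \<otimes> q)" using below_left[of p \<one> "inv p \<otimes> q"] pq by simp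
    show "\<not> below b (inv p \<otimes> q) \<one>" using below_left[of p "inv p \<otimes> q" \<one>] pq by simp
  qed (use pq in simp)
qed

end

lemma law_imp_line_or_ascending:
  assumes "is_law n w" "satisfies_law G n w"
  shows "linear_betweenness \<or> (\<exists>b. ascending b)"
proof (rule ccontr)
  assume n: "\<not> ?thesis"
  then obtain x y z where c: "x \<in> carrier G" "y \<in> carrier G" "z \<in> carrier G"
    and pos: "0 < D x y" "0 < D y z" "0 < D x z"
    and ns: "\<not> Sep x y z" "\<not> Sep y x z" "\<not> Sep z x y"
    by (auto simp: linear_betweenness_def)
  have ns': "\<not> Sep x z y" "\<not> Sep y z x" "\<not> Sep z y x" using ns Sep_sym c by blast+
  have pos': "0 < D y x" "0 < D z y" "0 < D z x" using pos D_commute c by auto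
  define v where "v i = (if i = 0 then x else if i = 1 then y else z)" for i :: nat
  have lt3: "i < 3 \<longleftrightarrow> i = 0 \<or> i = 1 \<or> i = 2" for i :: nat by auto
  have "\<not> satisfies_law G n w"
  proof (rule no_law_of_triple[of v])
    show "v i \<in> carrier G" if "i < 3" for i using c by (simp add: v_def)
    show "0 < D (v i) (v j)" if "i < 3" "j < 3" "i \<noteq> j" for i j
      using that pos pos' unfolding lt3 by (auto simp: v_def)
    show "\<not> Sep (v i) (v j) (v k)" if "i < 3" "j < 3" "k < 3" "j \<noteq> i" "k \<noteq> i" "j \<noteq> k" for i j k
      using that ns ns' unfolding lt3 by (auto simp: v_def)
  qed (use n assms in auto)
  then show False using assms by blast
qed

end

section \<open>Word length\<close>

locale generated_group = group G for G (structure) +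
  fixes S :: "'a set"
  assumes gen: "finite_generating_set G S"
begin

abbreviation len :: "'a \<Rightarrow> real" where "len g \<equiv> real (word_length G S g)"

lemma S_subset: "S \<subseteq> carrier G" and finite_S: "finite S" and generate_S: "generate G S = carrier G"
  using gen by (auto simp: finite_generating_set_def)

lemma len_one [simp]: "word_length G S \<one> = 0"
  by (rule word_length_one[OF S_subset])

lemma word_length_inv [simp]: "g \<in> carrier G \<Longrightarrow> word_length G S (inv g) = word_length G S g"
  using word_length_inv_le[OF S_subset, of g] word_length_inv_le[OF S_subset, of "inv g"]
  by (simp add: generate_S)

lemma len_mult_le: "g \<in> carrier G \<Longrightarrow> h \<in> carrier G \<Longrightarrow> len (g \<otimes> h) \<le> len g + len h"
  using word_length_mult_le[OF S_subset, of g h] by (simp add: generate_S)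

lemma mspace_word [simp]: "mspace (word_metric G S) = carrier G"
  and mdist_word: "x \<in> carrier G \<Longrightarrow> y \<in> carrier G \<Longrightarrow>
     mdist (word_metric G S) x y = len (inv x \<otimes> y)"
  by (simp_all add: word_metric_simps[OF gen] word_dist_def)

definition len_ball :: "real \<Rightarrow> 'a set" where
  "len_ball r = {g \<in> carrier G. len g \<le> r}"

lemma finite_len_ball: "finite (len_ball r)"
proof -
  let ?A = "S \<union> (\<lambda>s. inv s) ` S"
  have "len_ball r \<subseteq> (\<lambda>ws. foldr (\<otimes>) ws \<one>) ` {ws. set ws \<subseteq> ?A \<and> length ws \<le> nat \<lfloor>r\<rfloor>}"
  proof
    fix g assume g: "g \<in> len_ball r"
    then obtain ws where ws: "length ws = word_length G S g" "spells S ws g"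
      using word_length_attained[OF S_subset, of g] by (auto simp: len_ball_def generate_S)
    moreover have "length ws \<le> nat \<lfloor>r\<rfloor>" using g ws by (auto simp: len_ball_def le_nat_floor)
    ultimately show "g \<in> (\<lambda>ws. foldr (\<otimes>) ws \<one>) ` {ws. set ws \<subseteq> ?A \<and> length ws \<le> nat \<lfloor>r\<rfloor>}"
      by (auto simp: spells_def)
  qed
  moreover have "finite {ws. set ws \<subseteq> ?A \<and> length ws \<le> nat \<lfloor>r\<rfloor>}"
    by (rule finite_lists_length_le) (simp add: finite_S)
  ultimately show ?thesis by (meson finite_surj)
qed

text \<open>
  The prefixes of a shortest word.
\<close>

lemma geodesic:
  assumes g: "g \<in> carrier G"
  shows "\<exists>c :: nat \<Rightarrow> 'a. c 0 = \<one> \<and> c (word_length G S g) = g \<and>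
    (\<forall>k. c k \<in> carrier G) \<and>
    (\<forall>j k. j \<le> k \<longrightarrow> k \<le> word_length G S g \<longrightarrow> word_length G S (inv (c j) \<otimes> c k) = k - j)"
proof -
  obtain ws where ws: "length ws = word_length G S g" "spells S ws g"
    using word_length_attained[OF S_subset, of g] g by (auto simp: generate_S)
  have wc: "set ws \<subseteq> carrier G" using spells_closed[OF S_subset ws(2)] .
  define c where "c k = foldr (\<otimes>) (take k ws) \<one>" for k
  have sub: "set (take k vs) \<subseteq> set vs" "set (drop k vs) \<subseteq> set vs" for k and vs :: "'a list"
    by (rule set_take_subset set_drop_subset)+
  have sp: "spells S (take k (drop j ws)) (foldr (\<otimes>) (take k (drop j ws)) \<one>)" for j k
  proof -
    have "set (take k (drop j ws)) \<subseteq> set ws" using sub by blast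
    then show ?thesis using ws(2) by (auto simp: spells_def)
  qed
  have cc: "c k \<in> carrier G" for k unfolding c_def
    using sub wc by (intro foldr_mult_closed) blast
  have step: "inv (c j) \<otimes> c k = foldr (\<otimes>) (take (k - j) (drop j ws)) \<one>" if "j \<le> k" for j k
  proof -
    have "set (take j ws) \<subseteq> carrier G" "set (take (k - j) (drop j ws)) \<subseteq> carrier G" 
      using sub wc by blast+
    moreover have "take k ws = take j ws @ take (k - j) (drop j ws)"
      using that by (metis le_add_diff_inverse take_add)
    ultimately show ?thesis
      using cc[of j] foldr_mult_closed[of "take (k - j) (drop j ws)"]
      by (simp add: c_def foldr_mult_append del: foldr_append)
  qed
  have up: "word_length G S (inv (c j) \<otimes> c k) \<le> k - j" if "j \<le> k" for j k
    using word_length_le[OF S_subset sp[of "k - j" j]] step[OF that] by simp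
  have c0: "c 0 = \<one>" by (simp add: c_def)
  have cL: "c (word_length G S g) = g" using ws by (simp add: c_def spells_def)
  have "word_length G S (inv (c j) \<otimes> c k) = k - j" if jk: "j \<le> k" "k \<le> word_length G S g" for j k
  proof -
    have "g = (inv (c 0) \<otimes> c j) \<otimes> ((inv (c j) \<otimes> c k) \<otimes> (inv (c k) \<otimes> c (word_length G S g)))"
      using cc g by (simp add: c0 cL m_assoc)
    then have "len g \<le> len (inv (c 0) \<otimes> c j) + (len (inv (c j) \<otimes> c k)
        + len (inv (c k) \<otimes> c (word_length G S g)))"
      using len_mult_le[of "inv (c 0) \<otimes> c j" "(inv (c j) \<otimes> c k) \<otimes> (inv (c k) \<otimes> c (word_length G S g))"]
        len_mult_le[of "inv (c j) \<otimes> c k" "inv (c k) \<otimes> c (word_length G S g)"] cc by simp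
    then show ?thesis using up[of 0 j] up[of j k] up[of k "word_length G S g"] jk by linarith
  qed
  then show ?thesis using c0 cL cc by blast
qed

lemma exists_of_length:
  assumes "infinite (carrier G)"
  shows "\<exists>g\<in>carrier G. word_length G S g = m"
proof -
  have "\<not> carrier G \<subseteq> len_ball m" using assms finite_len_ball finite_subset by blast
  then obtain g where g: "g \<in> carrier G" "m < word_length G S g" by (auto simp: len_ball_def subset_iff not_le)
  obtain c where c: "c 0 = \<one>" "\<forall>k. c k \<in> carrier G"
    "\<forall>j k. j \<le> k \<longrightarrow> k \<le> word_length G S g \<longrightarrow> word_length G S (inv (c j) \<otimes> c k) = k - j"
    using geodesic[OF g(1)] by blast
  have "word_length G S (inv (c 0) \<otimes> c m) = m - 0" using c(3) g(2) by force
  then show ?thesis using c by (intro bexI[of _ "c m"]) auto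
qed

end

lemma (in group) virtually_cyclicI:
  assumes t: "t \<in> carrier G" and B: "finite B" "B \<subseteq> carrier G"
    and cov: "\<And>g. g \<in> carrier G \<Longrightarrow> \<exists>k::int. \<exists>b\<in>B. g = t [^] k \<otimes> b"
  shows "virtually_cyclic G"
proof -
  define H where "H = range (\<lambda>k::int. t [^] k)"
  have H: "subgroup H G" unfolding H_def by (rule subgroup_of_powers[OF t])
  have tH: "t \<in> H" unfolding H_def using t by (metis int_pow_1 rangeI)
  interpret H: group "G\<lparr>carrier := H\<rparr>" by (rule subgroup_imp_group[OF H])
  have "cyclic_group (G\<lparr>carrier := H\<rparr>)"
  proof -
    have "H = range (\<lambda>k::int. t [^] k)" by (simp only: H_def)
    also have "\<dots> = range (\<lambda>k::int. t [^]\<^bsub>G\<lparr>carrier := H\<rparr>\<^esub> k)"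
      by (intro image_cong refl int_pow_consistent[OF H tH])
    finally have "H = range (\<lambda>k::int. t [^]\<^bsub>G\<lparr>carrier := H\<rparr>\<^esub> k)" .
    then show ?thesis unfolding H.cyclic_group using tH by auto
  qed
  moreover have "rcosets H \<subseteq> (\<lambda>b. H #> b) ` B"
  proof
    fix C assume "C \<in> rcosets H"
    then obtain g where g: "g \<in> carrier G" "C = H #> g" by (auto simp: RCOSETS_def)
    obtain k :: int and b where b: "b \<in> B" "g = t [^] k \<otimes> b" using cov[OF g(1)] by blast
    have "g \<in> H #> b" using b by (auto simp: r_coset_def H_def)
    then have "H #> b = H #> g" using repr_independence H b B by blast
    then show "C \<in> (\<lambda>b. H #> b) ` B" using g b by auto
  qed
  then have "finite (rcosets H)" using B finite_surj by blast
  ultimately show ?thesis using H by (auto simp: virtually_cyclic_def)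
qed

lemma (in group) infinite_if_not_virtually_cyclic:
  "\<not> virtually_cyclic G \<Longrightarrow> infinite (carrier G)"
  using virtually_cyclicI[of \<one> "carrier G"] by force

section \<open>The group acting on the asymptotic cone\<close>

locale word_cone = generated_group G S for G (structure) and S +
  fixes I :: "'i set" and \<omega> :: "'i filter" and d :: "'i \<Rightarrow> real"
  assumes uf: "nonprincipal_ultrafilter_on I \<omega>" and sc: "scaling_sequence I \<omega> d"
begin

abbreviation seqs :: "('i \<Rightarrow> 'a) set" where
  "seqs \<equiv> cone_sequences (word_metric G S) I \<omega> (\<lambda>_. \<one>) d"

abbreviation cd :: "('i \<Rightarrow> 'a) \<Rightarrow> ('i \<Rightarrow> 'a) \<Rightarrow> real" where
  "cd \<equiv> cone_pdist (word_metric G S) \<omega> d"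

lemma base_in: "\<one> \<in> mspace (word_metric G S)" by simp

lemmas cd_tendsto = cone_pdist_tendsto[OF uf sc base_in]
  and cd_nonneg = cone_pdist_nonneg[OF uf sc base_in]
  and cd_refl = cone_pdist_refl[OF uf sc base_in]
  and cd_commute = cone_pdist_commute[OF uf sc base_in]
  and cd_triangle = cone_pdist_triangle[OF uf sc base_in]
  and rel_equiv = equiv_cone_rel[OF uf sc base_in]
  and ev_index = ev_I[OF uf sc base_in]
  and \<omega>_nonbot = nbot[OF uf sc base_in]

lemma d_pos: "i \<in> I \<Longrightarrow> 0 < d i" and d_at_top: "filterlim d at_top \<omega>"
  using sc by (auto simp: scaling_sequence_def)

lemma ultra: "\<not> eventually P \<omega> \<Longrightarrow> eventually (\<lambda>i. \<not> P i) \<omega>"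
  using uf by (auto simp: nonprincipal_ultrafilter_on_def)

lemma seqs_closed [simp]: "x \<in> seqs \<Longrightarrow> i \<in> I \<Longrightarrow> x i \<in> carrier G"
  by (auto simp: cone_sequences_def)

lemma seqs_extensional: "x \<in> seqs \<Longrightarrow> x \<in> extensional I"
  unfolding cone_sequences_def PiE_def by blast

lemma seqs_eqI: "x \<in> seqs \<Longrightarrow> y \<in> seqs \<Longrightarrow> (\<And>i. i \<in> I \<Longrightarrow> x i = y i) \<Longrightarrow> x = y"
  using seqs_extensional extensionalityI by metis

lemma seqsI:
  assumes x: "x \<in> I \<rightarrow>\<^sub>E carrier G" and b: "eventually (\<lambda>i. len (x i) \<le> K * d i) \<omega>"
  shows "x \<in> seqs"
proof -
  have "eventually (\<lambda>i. mdist (word_metric G S) (x i) \<one> / d i \<in> {0..K}) \<omega>"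
    using b ev_index
  proof eventually_elim
    case (elim i)
    have "x i \<in> carrier G" using x elim by auto
    then have "mdist (word_metric G S) (x i) \<one> = len (x i)" by (simp add: mdist_word)
    then show ?case using elim d_pos[of i] by (simp add: divide_le_eq)
  qed
  then obtain L where "((\<lambda>i. mdist (word_metric G S) (x i) \<one> / d i) \<longlongrightarrow> L) \<omega>"
    by (rule ultrafilter_bounded_tendsto[OF uf])
  then show ?thesis using x by (auto simp: cone_sequences_def)
qed

lemma seqs_bounded:
  assumes x: "x \<in> seqs"
  shows "\<exists>K. eventually (\<lambda>i. len (x i) \<le> K * d i) \<omega>"
proof -
  obtain L where L: "((\<lambda>i. mdist (word_metric G S) (x i) \<one> / d i) \<longlongrightarrow> L) \<omega>"
    using x by (auto simp: cone_sequences_def)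
  have "eventually (\<lambda>i. mdist (word_metric G S) (x i) \<one> / d i < L + 1) \<omega>"
    by (rule order_tendstoD(2)[OF L]) simp
  then have "eventually (\<lambda>i. len (x i) \<le> (L + 1) * d i) \<omega>"
    using ev_index
  proof eventually_elim
    case (elim i)
    then have "mdist (word_metric G S) (x i) \<one> = len (x i)" using x by (simp add: mdist_word)
    then show ?case using elim d_pos[of i] by (simp add: divide_less_eq)
  qed
  then show ?thesis by blast
qed

lemma cd_tendsto_len:
  assumes "x \<in> seqs" "y \<in> seqs"
  shows "((\<lambda>i. len (inv (x i) \<otimes> y i) / d i) \<longlongrightarrow> cd x y) \<omega>"
proof -
  have "eventually (\<lambda>i. mdist (word_metric G S) (x i) (y i) / d i = len (inv (x i) \<otimes> y i) / d i) \<omega>"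
    using ev_index by eventually_elim (use assms in \<open>simp add: mdist_word\<close>)
  from tendsto_cong[OF this] show ?thesis using cd_tendsto[OF assms] by blast
qed

lemma cd_less_eventually:
  assumes "x \<in> seqs" "y \<in> seqs" "cd x y < c"
  shows "eventually (\<lambda>i. len (inv (x i) \<otimes> y i) < c * d i) \<omega>"
  using order_tendstoD(2)[OF cd_tendsto_len[OF assms(1,2)] assms(3)] ev_index
  by eventually_elim (use d_pos in \<open>simp add: divide_less_eq\<close>)

lemma cd_greater_eventually:
  assumes "x \<in> seqs" "y \<in> seqs" "c < cd x y"
  shows "eventually (\<lambda>i. c * d i < len (inv (x i) \<otimes> y i)) \<omega>"
  using order_tendstoD(1)[OF cd_tendsto_len[OF assms(1,2)] assms(3)] ev_index
  by eventually_elim (use d_pos in \<open>simp add: less_divide_eq\<close>)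

lemma cd_leI:
  assumes "x \<in> seqs" "y \<in> seqs" "eventually (\<lambda>i. len (inv (x i) \<otimes> y i) \<le> c * d i) \<omega>"
  shows "cd x y \<le> c"
proof (rule tendsto_upperbound[OF cd_tendsto_len[OF assms(1,2)] _ \<omega>_nonbot])
  show "eventually (\<lambda>i. len (inv (x i) \<otimes> y i) / d i \<le> c) \<omega>"
    using assms(3) ev_index by eventually_elim (use d_pos in \<open>simp add: divide_le_eq\<close>)
qed

lemma cd_geI:
  assumes "x \<in> seqs" "y \<in> seqs" "eventually (\<lambda>i. c * d i \<le> len (inv (x i) \<otimes> y i)) \<omega>"
  shows "c \<le> cd x y"
proof (rule tendsto_lowerbound[OF cd_tendsto_len[OF assms(1,2)] _ \<omega>_nonbot])
  show "eventually (\<lambda>i. c \<le> len (inv (x i) \<otimes> y i) / d i) \<omega>"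
    using assms(3) ev_index by eventually_elim (use d_pos in \<open>simp add: le_divide_eq\<close>)
qed

text \<open>
  The group \<open>\<Gamma>\<close> of the introduction. It is not divided by the sequences of sublinear length:
  points of the cone are then handled through arbitrary representatives, at the price that \<open>cd\<close>
  is only a pseudometric.
\<close>

definition cone_group :: "('i \<Rightarrow> 'a) monoid" where
  "cone_group = \<lparr>carrier = seqs, monoid.mult = (\<lambda>x y. \<lambda>i\<in>I. x i \<otimes> y i), one = (\<lambda>i\<in>I. \<one>)\<rparr>"

lemma carrier_cone_group [simp]: "carrier cone_group = seqs"
  and mult_cone_group: "x \<otimes>\<^bsub>cone_group\<^esub> y = (\<lambda>i\<in>I. x i \<otimes> y i)"
  and one_cone_group: "\<one>\<^bsub>cone_group\<^esub> = (\<lambda>i\<in>I. \<one>)"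
  by (simp_all add: cone_group_def)

lemma mult_cone_group_apply [simp]: "i \<in> I \<Longrightarrow> (x \<otimes>\<^bsub>cone_group\<^esub> y) i = x i \<otimes> y i"
  and one_cone_group_apply [simp]: "i \<in> I \<Longrightarrow> \<one>\<^bsub>cone_group\<^esub> i = \<one>"
  by (simp_all add: mult_cone_group one_cone_group)

lemma seqs_inverse: "x \<in> seqs \<Longrightarrow> (\<lambda>i\<in>I. inv (x i)) \<in> seqs"
proof -
  assume x: "x \<in> seqs"
  obtain K where K: "eventually (\<lambda>i. len (x i) \<le> K * d i) \<omega>" using seqs_bounded[OF x] by blast
  show ?thesis
  proof (rule seqsI[where K = K])
    show "eventually (\<lambda>i. len ((\<lambda>i\<in>I. inv (x i)) i) \<le> K * d i) \<omega>"
      using K ev_index by eventually_elim (use x in simp)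
  qed (use x in auto)
qed

lemma seqs_mult: "x \<in> seqs \<Longrightarrow> y \<in> seqs \<Longrightarrow> (\<lambda>i\<in>I. x i \<otimes> y i) \<in> seqs"
proof -
  assume x: "x \<in> seqs" and y: "y \<in> seqs"
  obtain K L where K: "eventually (\<lambda>i. len (x i) \<le> K * d i) \<omega>"
    and L: "eventually (\<lambda>i. len (y i) \<le> L * d i) \<omega>"
    using seqs_bounded[OF x] seqs_bounded[OF y] by blast
  show ?thesis
  proof (rule seqsI[where K = "K + L"])
    show "eventually (\<lambda>i. len ((\<lambda>i\<in>I. x i \<otimes> y i) i) \<le> (K + L) * d i) \<omega>"
      using K L ev_index
    proof eventually_elim
      case (elim i)
      then show ?case using len_mult_le[of "x i" "y i"] x y by (simp add: algebra_simps)
    qed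
  qed (use x y in auto)
qed

lemma group_cone_group: "group cone_group"
proof (rule groupI)
  show "\<one>\<^bsub>cone_group\<^esub> \<in> carrier cone_group"
    by (auto simp: one_cone_group intro!: seqsI[where K = 0] eventually_mono[OF ev_index])
  then have one: "\<one>\<^bsub>cone_group\<^esub> \<in> seqs" by simp
  show mult: "x \<otimes>\<^bsub>cone_group\<^esub> y \<in> carrier cone_group"
    if "x \<in> carrier cone_group" "y \<in> carrier cone_group" for x y
    using that seqs_mult by (simp add: mult_cone_group)
  show "(x \<otimes>\<^bsub>cone_group\<^esub> y) \<otimes>\<^bsub>cone_group\<^esub> z = x \<otimes>\<^bsub>cone_group\<^esub> (y \<otimes>\<^bsub>cone_group\<^esub> z)"
    if "x \<in> carrier cone_group" "y \<in> carrier cone_group" "z \<in> carrier cone_group" for x y z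
    using that mult by (intro seqs_eqI) (auto simp: m_assoc)
  show "\<one>\<^bsub>cone_group\<^esub> \<otimes>\<^bsub>cone_group\<^esub> x = x" if "x \<in> carrier cone_group" for x
    using that mult one by (intro seqs_eqI) auto
  show "\<exists>y\<in>carrier cone_group. y \<otimes>\<^bsub>cone_group\<^esub> x = \<one>\<^bsub>cone_group\<^esub>"
    if "x \<in> carrier cone_group" for x
    using that mult one seqs_inverse[of x]
    by (intro bexI[of _ "\<lambda>i\<in>I. inv (x i)"] seqs_eqI) auto
qed

sublocale \<Gamma>: group cone_group by (rule group_cone_group)

lemma inv_cone_group: "x \<in> seqs \<Longrightarrow> inv\<^bsub>cone_group\<^esub> x = (\<lambda>i\<in>I. inv (x i))"
  by (rule \<Gamma>.inv_equality)
    (use seqs_inverse[of x] \<Gamma>.m_closed[of "\<lambda>i\<in>I. inv (x i)" x] \<Gamma>.one_closed in \<open>auto intro!: seqs_eqI\<close>)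

lemma inv_cone_group_apply [simp]: "x \<in> seqs \<Longrightarrow> i \<in> I \<Longrightarrow> (inv\<^bsub>cone_group\<^esub> x) i = inv (x i)"
  by (simp add: inv_cone_group)

lemma one_seqs [simp]: "\<one>\<^bsub>cone_group\<^esub> \<in> seqs"
  and mult_seqs [simp]: "x \<in> seqs \<Longrightarrow> y \<in> seqs \<Longrightarrow> x \<otimes>\<^bsub>cone_group\<^esub> y \<in> seqs"
  and inv_seqs [simp]: "x \<in> seqs \<Longrightarrow> inv\<^bsub>cone_group\<^esub> x \<in> seqs"
  using \<Gamma>.one_closed \<Gamma>.m_closed \<Gamma>.inv_closed by simp_all

lemma word_value_cone_group:
  assumes a: "\<And>j. j \<in> fst ` set w \<Longrightarrow> a j \<in> seqs" and i: "i \<in> I"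
  shows "word_value cone_group a w i = word_value G (\<lambda>j. a j i) w"
  using a
proof (induction w)
  case (Cons l w)
  then show ?case using i by (cases l) (auto simp: word_value_def)
qed (simp add: word_value_def i)

lemma cone_group_satisfies_law:
  assumes law: "is_law n w" and sat: "satisfies_law G n w"
  shows "satisfies_law cone_group n w"
  unfolding satisfies_law_def
proof
  fix a assume a: "a \<in> {1..n} \<rightarrow> carrier cone_group"
  have in_w: "a j \<in> seqs" if "j \<in> fst ` set w" for j using that law a by (auto simp: is_law_def)
  have v: "word_value cone_group a w \<in> seqs"
  proof -
    have "set (map (\<lambda>(i, b). if b then a i else inv\<^bsub>cone_group\<^esub> a i) w) \<subseteq> carrier cone_group"
      using in_w by force
    then show ?thesis using \<Gamma>.foldr_mult_closed unfolding word_value_def by simp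
  qed
  show "word_value cone_group a w = \<one>\<^bsub>cone_group\<^esub>"
  proof (rule seqs_eqI[OF v one_seqs])
    fix i assume i: "i \<in> I"
    have "(\<lambda>j. a j i) \<in> {1..n} \<rightarrow> carrier G" using Pi_mem[OF a] i by (intro Pi_I) simp
    then show "word_value cone_group a w i = \<one>\<^bsub>cone_group\<^esub> i"
      using sat word_value_cone_group[OF in_w i] i by (simp add: satisfies_law_def)
  qed
qed

lemma cd_left:
  assumes "g \<in> seqs" "x \<in> seqs" "y \<in> seqs"
  shows "cd (g \<otimes>\<^bsub>cone_group\<^esub> x) (g \<otimes>\<^bsub>cone_group\<^esub> y) = cd x y"
proof -
  let ?gx = "g \<otimes>\<^bsub>cone_group\<^esub> x" and ?gy = "g \<otimes>\<^bsub>cone_group\<^esub> y"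
  have "eventually (\<lambda>i. len (inv (?gx i) \<otimes> ?gy i) / d i = len (inv (x i) \<otimes> y i) / d i) \<omega>"
    using ev_index by eventually_elim (use assms in \<open>simp add: inv_mult_group m_assoc\<close>)
  from tendsto_cong[OF this] have "((\<lambda>i. len (inv (x i) \<otimes> y i) / d i) \<longlongrightarrow> cd ?gx ?gy) \<omega>"
    using cd_tendsto_len[of ?gx ?gy] assms by simp
  then show ?thesis using tendsto_unique[OF \<omega>_nonbot] cd_tendsto_len[OF assms(2,3)] by blast
qed

lemma cd_one_less_eventually:
  assumes "x \<in> seqs" "cd \<one>\<^bsub>cone_group\<^esub> x < c"
  shows "eventually (\<lambda>i. len (x i) < c * d i) \<omega>"
  using cd_less_eventually[OF one_seqs assms] ev_index
  by eventually_elim (use assms in simp)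

lemma cd_one_leI: 
  assumes x: "x \<in> seqs" and b: "eventually (\<lambda>i. len (x i) \<le> c * d i) \<omega>"
  shows "cd \<one>\<^bsub>cone_group\<^esub> x \<le> c"
proof (rule cd_leI[OF one_seqs x])
  show "eventually (\<lambda>i. len (inv (\<one>\<^bsub>cone_group\<^esub> i) \<otimes> x i) \<le> c * d i) \<omega>"
    using b ev_index by eventually_elim (use x in simp)
qed

lemma seq_of_eventually:
  assumes x: "eventually (\<lambda>i. x i \<in> carrier G \<and> len (x i) \<le> K * d i) \<omega>"
  shows "\<exists>x'\<in>seqs. eventually (\<lambda>i. x' i = x i) \<omega> \<and> cd \<one>\<^bsub>cone_group\<^esub> x' \<le> K"
proof -
  define x' where "x' = (\<lambda>i\<in>I. if x i \<in> carrier G then x i else \<one>)"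
  have eq: "eventually (\<lambda>i. x' i = x i) \<omega>"
    using x ev_index by eventually_elim (simp add: x'_def)
  have b: "eventually (\<lambda>i. len (x' i) \<le> K * d i) \<omega>"
    using x eq by eventually_elim simp
  have "x' \<in> seqs" by (rule seqsI[OF _ b]) (auto simp: x'_def)
  then show ?thesis using eq cd_one_leI[OF _ b] by blast
qed

text \<open>
  A property of all representatives of bounded length holds on whole balls of \<open>G\<close> at almost every
  index: otherwise violators, chosen index by index, would form a representative that violates it.
\<close>

lemma bounded_transfer:
  assumes "\<And>x. x \<in> seqs \<Longrightarrow> cd \<one>\<^bsub>cone_group\<^esub> x \<le> K \<Longrightarrow> \<not> eventually (\<lambda>i. \<not> Q i (x i)) \<omega>"
  shows "eventually (\<lambda>i. \<forall>g\<in>len_ball (K * d i). Q i g) \<omega>"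
proof (rule ccontr)
  assume "\<not> ?thesis"
  from ultra[OF this] have ev: "eventually (\<lambda>i. \<exists>g\<in>len_ball (K * d i). \<not> Q i g) \<omega>" by simp
  define x where "x i = (SOME g. g \<in> len_ball (K * d i) \<and> \<not> Q i g)" for i
  have x: "eventually (\<lambda>i. x i \<in> len_ball (K * d i) \<and> \<not> Q i (x i)) \<omega>"
    using ev
  proof eventually_elim
    case (elim i)
    then have "\<exists>g. g \<in> len_ball (K * d i) \<and> \<not> Q i g" by blast
    then show ?case unfolding x_def by (rule someI_ex)
  qed
  have "eventually (\<lambda>i. x i \<in> carrier G \<and> len (x i) \<le> K * d i) \<omega>"
    using x by eventually_elim (simp add: len_ball_def)
  from seq_of_eventually[OF this] obtain x' where x': "x' \<in> seqs" "eventually (\<lambda>i. x' i = x i) \<omega>"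
    "cd \<one>\<^bsub>cone_group\<^esub> x' \<le> K" by blast
  have "eventually (\<lambda>i. \<not> Q i (x' i)) \<omega>" using x x'(2) by eventually_elim simp
  then show False using assms x' by blast
qed

section \<open>Separation in the asymptotic cone\<close>

abbreviation cone :: "('i \<Rightarrow> 'a) set metric" where
  "cone \<equiv> asymptotic_cone (word_metric G S) I \<omega> (\<lambda>_. \<one>) d"

definition cls :: "('i \<Rightarrow> 'a) \<Rightarrow> ('i \<Rightarrow> 'a) set" where
  "cls x = cone_rel (word_metric G S) I \<omega> (\<lambda>_. \<one>) d `` {x}"

lemma mspace_cone: "mspace cone = cls ` seqs"
  by (auto simp: asymptotic_cone_simps[OF uf sc base_in] cone_points_def quotient_def cls_def)

lemma cls_mem: "x \<in> seqs \<Longrightarrow> x \<in> cls x"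
  using equiv_class_self[OF rel_equiv] by (simp add: cls_def)

lemma mdist_cone: "x \<in> seqs \<Longrightarrow> y \<in> seqs \<Longrightarrow> mdist cone (cls x) (cls y) = cd x y"
  using cone_dist_eq[OF uf sc base_in, of "cls x" "cls y" x y] mspace_cone cls_mem
  by (simp add: asymptotic_cone_simps[OF uf sc base_in])

lemma cls_eq_iff: "x \<in> seqs \<Longrightarrow> y \<in> seqs \<Longrightarrow> cls x = cls y \<longleftrightarrow> cd x y = 0"
  using mdist_cone[of x y] mdist_zero[of "cls x" cone "cls y"] by (simp add: mspace_cone)

abbreviation cone_minus :: "('i \<Rightarrow> 'a) \<Rightarrow> ('i \<Rightarrow> 'a) set topology" where
  "cone_minus p \<equiv> subtopology (mtopology_of cone) (topspace (mtopology_of cone) - {cls p})"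

text \<open>
  Points are given by representatives, and \<open>0 < cd p x\<close> says that \<open>x\<close> represents a point of the
  complement of \<open>p\<close>; without it a pair involving \<open>p\<close> itself would count as separated.
\<close>

definition sep :: "('i \<Rightarrow> 'a) \<Rightarrow> ('i \<Rightarrow> 'a) \<Rightarrow> ('i \<Rightarrow> 'a) \<Rightarrow> bool" where
  "sep p x y \<longleftrightarrow> 0 < cd p x \<and> 0 < cd p y \<and> \<not> path_component_of (cone_minus p) (cls x) (cls y)"

text \<open>
  The action of \<open>\<Gamma>\<close> on the cone. The choice of a representative does not matter, by \<open>translate_cls\<close>.
\<close>

definition translate :: "('i \<Rightarrow> 'a) \<Rightarrow> ('i \<Rightarrow> 'a) set \<Rightarrow> ('i \<Rightarrow> 'a) set" where
  "translate g P = cls (g \<otimes>\<^bsub>cone_group\<^esub> (SOME x. x \<in> seqs \<and> P = cls x))"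

lemma translate_cls:
  assumes "g \<in> seqs" "x \<in> seqs"
  shows "translate g (cls x) = cls (g \<otimes>\<^bsub>cone_group\<^esub> x)"
proof -
  define x' where "x' = (SOME x'. x' \<in> seqs \<and> cls x = cls x')"
  have "x' \<in> seqs \<and> cls x = cls x'" unfolding x'_def by (rule someI[of _ x]) (use assms in simp)
  moreover have "translate g (cls x) = cls (g \<otimes>\<^bsub>cone_group\<^esub> x')"
    by (simp only: translate_def x'_def)
  ultimately show ?thesis
    using assms cd_left[of g x x'] cls_eq_iff[of x x']
      cls_eq_iff[of "g \<otimes>\<^bsub>cone_group\<^esub> x" "g \<otimes>\<^bsub>cone_group\<^esub> x'"] by simp
qed

lemma continuous_translate:
  assumes g: "g \<in> seqs"
  shows "continuous_map (mtopology_of cone) (mtopology_of cone) (translate g)"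
proof (rule Lipschitz_continuous_imp_continuous_map)
  have "mdist cone (translate g P) (translate g Q) \<le> 1 * mdist cone P Q"
    if "P \<in> mspace cone" "Q \<in> mspace cone" for P Q
    using that g by (auto simp: mspace_cone translate_cls mdist_cone cd_left)
  then show "Lipschitz_continuous_map cone cone (translate g)"
    unfolding Lipschitz_continuous_map_def
    by (intro conjI exI[of _ 1]) (use g in \<open>auto simp: mspace_cone translate_cls\<close>)
qed

lemma path_component_translate:
  assumes c: "g \<in> seqs" "p \<in> seqs" "x \<in> seqs" "y \<in> seqs"
    and pc: "path_component_of (cone_minus p) (cls x) (cls y)"
  shows "path_component_of (cone_minus (g \<otimes>\<^bsub>cone_group\<^esub> p))
    (cls (g \<otimes>\<^bsub>cone_group\<^esub> x)) (cls (g \<otimes>\<^bsub>cone_group\<^esub> y))"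
proof -
  have "continuous_map (cone_minus p) (cone_minus (g \<otimes>\<^bsub>cone_group\<^esub> p)) (translate g)"
  proof (intro continuous_map_into_subtopology continuous_map_from_subtopology continuous_translate c)
    show "translate g \<in> topspace (cone_minus p)
        \<rightarrow> topspace (mtopology_of cone) - {cls (g \<otimes>\<^bsub>cone_group\<^esub> p)}"
    proof
      fix P assume P: "P \<in> topspace (cone_minus p)"
      then obtain z where z: "z \<in> seqs" "P = cls z" by (auto simp: mspace_cone)
      then have "cls z \<noteq> cls p" using P by auto
      then have "cls (g \<otimes>\<^bsub>cone_group\<^esub> z) \<noteq> cls (g \<otimes>\<^bsub>cone_group\<^esub> p)"
        using z c by (simp add: cls_eq_iff cd_left)
      then show "translate g P \<in> topspace (mtopology_of cone) - {cls (g \<otimes>\<^bsub>cone_group\<^esub> p)}"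
        using z c by (simp add: translate_cls mspace_cone)
    qed
  qed
  from path_component_of_continuous_image[OF this pc] show ?thesis using c by (simp add: translate_cls)
qed

text \<open>
  Cones of word metrics are geodesic. At each index the path follows a shortest word from \<open>x i\<close> to \<open>y i\<close>,
  with constant speed up to rounding; the rounding error of one letter vanishes in the limit.
\<close>

lemma geodesic_path:
  assumes x: "x \<in> seqs" and y: "y \<in> seqs"
  obtains \<phi> where "\<And>t. t \<in> {0..1} \<Longrightarrow> \<phi> t \<in> seqs" "\<phi> 0 = x" "\<phi> 1 = y"
    "\<And>s t. s \<in> {0..1} \<Longrightarrow> t \<in> {0..1} \<Longrightarrow> cd (\<phi> s) (\<phi> t) \<le> \<bar>s - t\<bar> * cd x y"
proof -
  define L where "L i = word_length G S (inv (x i) \<otimes> y i)" for i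
  have "\<forall>i\<in>I. \<exists>c :: nat \<Rightarrow> 'a. c 0 = \<one> \<and> c (L i) = inv (x i) \<otimes> y i \<and>
    (\<forall>k. c k \<in> carrier G) \<and>
    (\<forall>j k. j \<le> k \<longrightarrow> k \<le> L i \<longrightarrow> word_length G S (inv (c j) \<otimes> c k) = k - j)"
    unfolding L_def using x y by (intro ballI geodesic) auto
  then obtain c where c: "\<And>i. i \<in> I \<Longrightarrow> c i 0 = \<one>" "\<And>i. i \<in> I \<Longrightarrow> c i (L i) = inv (x i) \<otimes> y i"
    "\<And>i k. i \<in> I \<Longrightarrow> c i k \<in> carrier G"
    "\<And>i j k. i \<in> I \<Longrightarrow> j \<le> k \<Longrightarrow> k \<le> L i \<Longrightarrow> word_length G S (inv (c i j) \<otimes> c i k) = k - j"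
    unfolding bchoice_iff by blast
  define \<phi> where "\<phi> t = (\<lambda>i\<in>I. x i \<otimes> c i (nat \<lfloor>t * real (L i)\<rfloor>))" for t :: real
  have fl: "nat \<lfloor>t * real (L i)\<rfloor> \<le> L i" if "t \<in> {0..1}" for t i
  proof -
    have "t * real (L i) \<le> 1 * real (L i)" using that by (intro mult_right_mono) auto
    then have "\<lfloor>t * real (L i)\<rfloor> \<le> int (L i)" by (simp add: floor_le_iff)
    then show ?thesis by simp
  qed
  have L_le: "eventually (\<lambda>i. real (L i) \<le> (cd x y + 1) * d i) \<omega>"
    using cd_less_eventually[OF x y, of "cd x y + 1"] by (auto elim!: eventually_mono simp: L_def)
  have len: "len (inv (\<phi> s i) \<otimes> \<phi> t i) \<le> (t - s) * real (L i) + 1"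
    if "i \<in> I" "s \<in> {0..1}" "t \<in> {0..1}" "s \<le> t" for i s t
  proof -
    let ?j = "nat \<lfloor>s * real (L i)\<rfloor>" and ?k = "nat \<lfloor>t * real (L i)\<rfloor>"
    have jk: "?j \<le> ?k" using that by (intro nat_mono floor_mono mult_right_mono) auto
    have "inv (\<phi> s i) \<otimes> \<phi> t i = inv (c i ?j) \<otimes> c i ?k"
      using that x c(3) by (simp add: \<phi>_def inv_mult_group m_assoc)
    then have "len (inv (\<phi> s i) \<otimes> \<phi> t i) = real ?k - real ?j"
      using c(4)[OF that(1) jk fl[OF that(3)]] jk by (simp add: of_nat_diff)
    also have "\<dots> \<le> (t - s) * real (L i) + 1"
    proof -
      have "0 \<le> s * real (L i)" "0 \<le> t * real (L i)" using that by auto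
      then have "real ?k \<le> t * real (L i)" "s * real (L i) - 1 \<le> real ?j" by linarith+
      then show ?thesis by (simp add: algebra_simps)
    qed
    finally show ?thesis .
  qed
  have \<phi>0: "\<phi> 0 = x" using x c(1) seqs_extensional[OF x]
    by (auto simp: \<phi>_def restrict_def extensional_def fun_eq_iff)
  have \<phi>1: "\<phi> 1 = y" using x y c(2) seqs_extensional[OF y]
    by (auto simp: \<phi>_def restrict_def extensional_def fun_eq_iff)
  have \<phi>_seqs: "\<phi> t \<in> seqs" if t: "t \<in> {0..1}" for t
  proof -
    obtain K where K: "eventually (\<lambda>i. len (x i) \<le> K * d i) \<omega>" using seqs_bounded[OF x] by blast
    show ?thesis
    proof (rule seqsI[where K = "K + (cd x y + 1)"])
      show "\<phi> t \<in> I \<rightarrow>\<^sub>E carrier G" using x c(3) by (auto simp: \<phi>_def)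
      show "eventually (\<lambda>i. len (\<phi> t i) \<le> (K + (cd x y + 1)) * d i) \<omega>"
        using K L_le ev_index
      proof eventually_elim
        case (elim i)
        let ?k = "nat \<lfloor>t * real (L i)\<rfloor>"
        have "word_length G S (inv (c i 0) \<otimes> c i ?k) = ?k - 0"
          using c(4)[of i 0 ?k] fl[OF t] elim by simp
        then have "len (c i ?k) = real ?k" using c(1,3)[of i] elim by simp
        moreover have "real ?k \<le> real (L i)" using fl[OF t, of i] by linarith
        ultimately have "len (c i ?k) \<le> real (L i)" by simp
        moreover have "len (\<phi> t i) \<le> len (x i) + len (c i ?k)"
          using len_mult_le[of "x i" "c i ?k"] x c(3) elim by (simp add: \<phi>_def)
        ultimately show ?case using elim by (simp add: algebra_simps)
      qed
    qed
  qed
  have inv0: "((\<lambda>i. 1 / d i) \<longlongrightarrow> 0) \<omega>"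
    using d_at_top by (intro tendsto_divide_0[OF tendsto_const] filterlim_at_top_imp_at_infinity)
  have lip: "cd (\<phi> s) (\<phi> t) \<le> (t - s) * cd x y" if st: "s \<in> {0..1}" "t \<in> {0..1}" "s \<le> t" for s t
  proof (rule tendsto_le[OF \<omega>_nonbot _ cd_tendsto_len[OF \<phi>_seqs[OF st(1)] \<phi>_seqs[OF st(2)]]])
    have "((\<lambda>i. (t - s) * (len (inv (x i) \<otimes> y i) / d i) + 1 / d i) \<longlongrightarrow> (t - s) * cd x y + 0) \<omega>"
      by (intro tendsto_intros cd_tendsto_len x y inv0)
    then show "((\<lambda>i. (t - s) * (len (inv (x i) \<otimes> y i) / d i) + 1 / d i) \<longlongrightarrow> (t - s) * cd x y) \<omega>"
      by simp
    show "eventually (\<lambda>i. len (inv (\<phi> s i) \<otimes> \<phi> t i) / d i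
        \<le> (t - s) * (len (inv (x i) \<otimes> y i) / d i) + 1 / d i) \<omega>"
      using ev_index
    proof eventually_elim
      case (elim i)
      have "len (inv (\<phi> s i) \<otimes> \<phi> t i) / d i \<le> ((t - s) * real (L i) + 1) / d i"
        using len[OF elim st] d_pos[OF elim] by (intro divide_right_mono) auto
      then show ?case by (simp add: L_def add_divide_distrib)
    qed
  qed
  have "cd (\<phi> s) (\<phi> t) \<le> \<bar>s - t\<bar> * cd x y" if "s \<in> {0..1}" "t \<in> {0..1}" for s t
    using lip[OF that] lip[OF that(2,1)] cd_commute[of "\<phi> s" "\<phi> t"] by (cases "s \<le> t") auto
  then show thesis using that \<phi>0 \<phi>1 \<phi>_seqs by blast
qed

text \<open>
  A geodesic from \<open>x\<close> to \<open>y\<close> avoids every point with strict triangle inequality.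
\<close>

lemma joined_off_geodesic:
  assumes c: "p \<in> seqs" "x \<in> seqs" "y \<in> seqs" and l: "cd x y < cd x p + cd p y"
  shows "path_component_of (cone_minus p) (cls x) (cls y)"
proof -
  obtain \<phi> where \<phi>: "\<And>t. t \<in> {0..1} \<Longrightarrow> \<phi> t \<in> seqs" "\<phi> 0 = x" "\<phi> 1 = y"
    "\<And>s t. s \<in> {0..1} \<Longrightarrow> t \<in> {0..1} \<Longrightarrow> cd (\<phi> s) (\<phi> t) \<le> \<bar>s - t\<bar> * cd x y"
    using geodesic_path[OF c(2,3)] by blast
  have "continuous_map (mtopology_of (submetric euclidean_metric {0..1})) (mtopology_of cone) (\<lambda>t. cls (\<phi> t))"
  proof (rule Lipschitz_continuous_imp_continuous_map)
    have "mdist cone (cls (\<phi> s)) (cls (\<phi> t)) \<le> cd x y * dist s t" if "s \<in> {0..1}" "t \<in> {0..1}" for s t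
      using \<phi>(4)[OF that] \<phi>(1) that by (simp add: mdist_cone dist_real_def mult.commute)
    then show "Lipschitz_continuous_map (submetric euclidean_metric {0..1}) cone (\<lambda>t. cls (\<phi> t))"
      unfolding Lipschitz_continuous_map_def
      by (intro conjI exI[of _ "cd x y"]) (use \<phi>(1) in \<open>auto simp: mspace_cone\<close>)
  qed
  then have "pathin (mtopology_of cone) (\<lambda>t. cls (\<phi> t))"
    by (simp add: pathin_def mtopology_of_submetric)
  moreover have "cls (\<phi> t) \<in> topspace (mtopology_of cone) - {cls p}" if t: "t \<in> {0..1}" for t
  proof -
    have "cls (\<phi> t) \<noteq> cls p"
    proof
      assume "cls (\<phi> t) = cls p"
      then have z: "cd (\<phi> t) p = 0" using \<phi>(1)[OF t] c cls_eq_iff by blast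
      have "cd x p \<le> cd (\<phi> 0) (\<phi> t) + 0" "cd p y \<le> 0 + cd (\<phi> t) (\<phi> 1)"
        using cd_triangle[of x "\<phi> t" p] cd_triangle[of p "\<phi> t" y] cd_commute[of p "\<phi> t"] z \<phi>(1)[OF t] c
        by (simp_all add: \<phi>(2,3))
      moreover have "cd (\<phi> 0) (\<phi> t) \<le> t * cd x y" "cd (\<phi> t) (\<phi> 1) \<le> (1 - t) * cd x y"
        using \<phi>(4)[of 0 t] \<phi>(4)[of t 1] t by auto
      ultimately show False using l by (simp add: algebra_simps)
    qed
    then show ?thesis using \<phi>(1)[OF t] by (simp add: mspace_cone)
  qed
  ultimately have "pathin (cone_minus p) (\<lambda>t. cls (\<phi> t))" by (simp add: pathin_subtopology)
  then show ?thesis unfolding path_component_of_def using \<phi>(2,3) by metis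
qed

text \<open>
  A one-point space has a cut-point by convention; no cone of an infinite group is one.
\<close>

lemma exists_far:
  assumes "infinite (carrier G)"
  shows "\<exists>x\<in>seqs. 0 < cd \<one>\<^bsub>cone_group\<^esub> x"
proof -
  have "\<forall>i. \<exists>g\<in>carrier G. word_length G S g = nat \<lfloor>d i\<rfloor>" using exists_of_length[OF assms] by blast
  then obtain g where g: "\<And>i. g i \<in> carrier G" "\<And>i. word_length G S (g i) = nat \<lfloor>d i\<rfloor>" by metis
  define x where "x = (\<lambda>i\<in>I. g i)"
  have "eventually (\<lambda>i. len (x i) \<le> 1 * d i) \<omega>"
    using ev_index by eventually_elim (use d_pos in \<open>auto simp: x_def g less_imp_le\<close>)
  then have x: "x \<in> seqs" by (rule seqsI[rotated]) (use g in \<open>auto simp: x_def\<close>)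
  have "eventually (\<lambda>i. 2 \<le> d i) \<omega>" using d_at_top by (simp add: filterlim_at_top)
  then have "eventually (\<lambda>i. 1/2 * d i \<le> len (inv (\<one>\<^bsub>cone_group\<^esub> i) \<otimes> x i)) \<omega>"
    using ev_index
  proof eventually_elim
    case (elim i)
    then have "inv (\<one>\<^bsub>cone_group\<^esub> i) \<otimes> x i = g i" using g by (simp add: x_def)
    moreover have "1/2 * d i \<le> real (nat \<lfloor>d i\<rfloor>)" using elim by linarith
    ultimately show ?case using g(2)[of i] by simp
  qed
  from cd_geI[OF one_seqs x this] show ?thesis using x by (intro bexI[of _ x]) auto
qed

lemma cut_point_imp_sep:
  assumes cut: "has_global_cut_point (mtopology_of cone)" and inf: "infinite (carrier G)"
  shows "\<exists>x\<in>seqs. \<exists>y\<in>seqs. sep \<one>\<^bsub>cone_group\<^esub> x y"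
proof -
  obtain P where P: "P \<in> mspace cone"
    "mspace cone = {P} \<or> \<not> path_connectedin (mtopology_of cone) (mspace cone - {P})"
    using cut by (auto simp: has_global_cut_point_def)
  obtain p where p: "p \<in> seqs" "P = cls p" using P(1) by (auto simp: mspace_cone)
  obtain x where x: "x \<in> seqs" "0 < cd \<one>\<^bsub>cone_group\<^esub> x" using exists_far[OF inf] by blast
  have "mspace cone \<noteq> {P}"
  proof
    assume "mspace cone = {P}"
    then have "cls \<one>\<^bsub>cone_group\<^esub> = P" "cls x = P" using x one_seqs unfolding mspace_cone by blast+
    then show False using x cls_eq_iff[of "\<one>\<^bsub>cone_group\<^esub>" x] by simp
  qed
  then have "\<not> path_connected_space (cone_minus p)" using P p by (auto simp: path_connectedin_def)
  then obtain x y where xy: "x \<in> seqs" "y \<in> seqs" "cls x \<noteq> cls p" "cls y \<noteq> cls p"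
    "\<not> path_component_of (cone_minus p) (cls x) (cls y)"
    by (auto simp: path_connected_space_iff_path_component mspace_cone)
  let ?q = "inv\<^bsub>cone_group\<^esub> p"
  have pos: "0 < cd p x" "0 < cd p y"
    using xy p cls_eq_iff[of p x] cls_eq_iff[of p y] cd_nonneg[of p x] cd_nonneg[of p y] by force+
  have "sep \<one>\<^bsub>cone_group\<^esub> (?q \<otimes>\<^bsub>cone_group\<^esub> x) (?q \<otimes>\<^bsub>cone_group\<^esub> y)"
    unfolding sep_def
  proof (intro conjI notI)
    show "0 < cd \<one>\<^bsub>cone_group\<^esub> (?q \<otimes>\<^bsub>cone_group\<^esub> x)" "0 < cd \<one>\<^bsub>cone_group\<^esub> (?q \<otimes>\<^bsub>cone_group\<^esub> y)"
      using cd_left[of ?q p x] cd_left[of ?q p y] pos p xy by simp_all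
    assume "path_component_of (cone_minus \<one>\<^bsub>cone_group\<^esub>)
      (cls (?q \<otimes>\<^bsub>cone_group\<^esub> x)) (cls (?q \<otimes>\<^bsub>cone_group\<^esub> y))"
    from path_component_translate[OF p(1) _ _ _ this] show False using xy p by simp
  qed
  then show ?thesis
    using mult_seqs[OF inv_seqs[OF p(1)] xy(1)] mult_seqs[OF inv_seqs[OF p(1)] xy(2)] by blast
qed

lemma separated_group_cone:
  assumes "has_global_cut_point (mtopology_of cone)" "infinite (carrier G)"
  shows "separated_group cone_group cd sep"
proof (intro separated_group.intro group_cone_group separated_group_axioms.intro, unfold carrier_cone_group)
  show "0 \<le> cd x y" if "x \<in> seqs" "y \<in> seqs" for x y using that by (rule cd_nonneg)
  show "cd x x = 0" if "x \<in> seqs" for x using that by (rule cd_refl)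
  show "cd x y = cd y x" for x y by (rule cd_commute)
  show "cd x z \<le> cd x y + cd y z" if "x \<in> seqs" "y \<in> seqs" "z \<in> seqs" for x y z
    using that by (rule cd_triangle)
  show "cd (g \<otimes>\<^bsub>cone_group\<^esub> x) (g \<otimes>\<^bsub>cone_group\<^esub> y) = cd x y"
    if "g \<in> seqs" "x \<in> seqs" "y \<in> seqs" for g x y using that by (rule cd_left)
  show "sep p y x" if "sep p x y" for p x y using that path_component_of_sym[of "cone_minus p" "cls y" "cls x"]
    by (auto simp: sep_def)
  show "sep p x z \<or> sep p z y"
    if "p \<in> seqs" "x \<in> seqs" "y \<in> seqs" "z \<in> seqs" "sep p x y" "0 < cd p z" for p x y z
    using that path_component_of_trans[of "cone_minus p" "cls x" "cls z" "cls y"]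
    by (auto simp: sep_def)
  show "cd x y = cd x p + cd p y" if "p \<in> seqs" "x \<in> seqs" "y \<in> seqs" "sep p x y" for p x y
  proof -
    have "\<not> cd x y < cd x p + cd p y" using that joined_off_geodesic[of p x y] by (auto simp: sep_def)
    then show ?thesis using cd_triangle[of x p y] that by simp
  qed
  show "0 < cd p x" if "sep p x y" for p x y using that by (simp add: sep_def)
  show "sep (g \<otimes>\<^bsub>cone_group\<^esub> p) (g \<otimes>\<^bsub>cone_group\<^esub> x) (g \<otimes>\<^bsub>cone_group\<^esub> y)"
    if c: "g \<in> seqs" "p \<in> seqs" "x \<in> seqs" "y \<in> seqs" and "sep p x y" for g p x y
    using that path_component_translate[of "inv\<^bsub>cone_group\<^esub> g" "g \<otimes>\<^bsub>cone_group\<^esub> p"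
        "g \<otimes>\<^bsub>cone_group\<^esub> x" "g \<otimes>\<^bsub>cone_group\<^esub> y"] by (auto simp: sep_def cd_left)
  show "\<exists>x\<in>seqs. \<exists>y\<in>seqs. sep \<one>\<^bsub>cone_group\<^esub> x y" by (rule cut_point_imp_sep[OF assms])
qed

end

section \<open>A cone that is a line\<close>

context word_cone
begin

text \<open>
  The ball of radius \<open>2/3 \<tau>\<close> is covered by the translates of a smaller one by \<open>t\<^sup>0\<close>, \<open>t\<^sup>\<plusminus>\<^sup>1\<close>. The radius \<open>3/5 \<tau>\<close>
  of the latter may be any number strictly between the \<open>\<tau>/2\<close> of \<open>line_near_translation\<close> and \<open>2/3 \<tau>\<close>: at an
  index with large scaling factor the two radii differ by more than one letter, so that a word can be
  read letter by letter while the rest beyond a power of \<open>t i\<close> stays in the small ball.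
\<close>

lemma virtually_cyclic_of_line:
  assumes sg: "separated_group cone_group cd sep"
    and line: "separated_group.linear_betweenness cone_group cd sep"
  shows "virtually_cyclic G"
proof -
  interpret sg: separated_group cone_group cd sep by (rule sg)
  obtain t where t: "t \<in> seqs" "sep \<one>\<^bsub>cone_group\<^esub> t (inv\<^bsub>cone_group\<^esub> t)"
    using sg.exists_translation by auto
  define \<tau> where "\<tau> = cd \<one>\<^bsub>cone_group\<^esub> t"
  have \<tau>: "0 < \<tau>" using t by (simp add: \<tau>_def sep_def)
  let ?r = "3/5 * \<tau>" and ?R = "2/3 * \<tau>"
  have "eventually (\<lambda>i. \<forall>g\<in>len_ball (?R * d i). len g < ?r * d i \<or>
      len (inv g \<otimes> t i) < ?r * d i \<or> len (inv g \<otimes> (inv\<^bsub>cone_group\<^esub> t) i) < ?r * d i) \<omega>"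
  proof (rule bounded_transfer)
    fix x assume x: "x \<in> seqs" "cd \<one>\<^bsub>cone_group\<^esub> x \<le> ?R"
    have "cd \<one>\<^bsub>cone_group\<^esub> x < ?r \<or> cd x t < ?r \<or> cd x (inv\<^bsub>cone_group\<^esub> t) < ?r"
      using sg.line_near_translation[OF line, of t x] t x \<tau> by (auto simp: \<tau>_def)
    then have "eventually (\<lambda>i. len (x i) < ?r * d i) \<omega> \<or> eventually (\<lambda>i. len (inv (x i) \<otimes> t i) < ?r * d i) \<omega>
      \<or> eventually (\<lambda>i. len (inv (x i) \<otimes> (inv\<^bsub>cone_group\<^esub> t) i) < ?r * d i) \<omega>"
      using cd_one_less_eventually[OF x(1), of ?r] cd_less_eventually[OF x(1) t(1), of ?r]
        cd_less_eventually[OF x(1) inv_seqs[OF t(1)], of ?r] by blast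
    then have ev: "eventually (\<lambda>i. len (x i) < ?r * d i \<or>
      len (inv (x i) \<otimes> t i) < ?r * d i \<or> len (inv (x i) \<otimes> (inv\<^bsub>cone_group\<^esub> t) i) < ?r * d i) \<omega>"
      by (elim disjE) (erule eventually_mono, blast)+
    show "\<not> eventually (\<lambda>i. \<not> (len (x i) < ?r * d i \<or>
      len (inv (x i) \<otimes> t i) < ?r * d i \<or> len (inv (x i) \<otimes> (inv\<^bsub>cone_group\<^esub> t) i) < ?r * d i)) \<omega>"
    proof
      assume "eventually (\<lambda>i. \<not> (len (x i) < ?r * d i \<or>
        len (inv (x i) \<otimes> t i) < ?r * d i \<or> len (inv (x i) \<otimes> (inv\<^bsub>cone_group\<^esub> t) i) < ?r * d i)) \<omega>"
      with ev have "eventually (\<lambda>i. False) \<omega>" by eventually_elim blast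
      then show False using \<omega>_nonbot by (simp add: eventually_False)
    qed
  qed
  moreover have "eventually (\<lambda>i. 15 / \<tau> \<le> d i) \<omega>" using d_at_top by (simp add: filterlim_at_top)
  ultimately have "eventually (\<lambda>i. i \<in> I \<and> 15 / \<tau> \<le> d i \<and> (\<forall>g\<in>len_ball (?R * d i). len g < ?r * d i \<or>
      len (inv g \<otimes> t i) < ?r * d i \<or> len (inv g \<otimes> (inv\<^bsub>cone_group\<^esub> t) i) < ?r * d i)) \<omega>"
    using ev_index by eventually_elim blast
  from eventually_happens'[OF \<omega>_nonbot this] obtain i where i: "i \<in> I" "15 / \<tau> \<le> d i"
    and near0: "\<forall>g\<in>len_ball (?R * d i). len g < ?r * d i \<or>
      len (inv g \<otimes> t i) < ?r * d i \<or> len (inv g \<otimes> (inv\<^bsub>cone_group\<^esub> t) i) < ?r * d i" by blast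
  let ?t = "t i"
  have tc: "?t \<in> carrier G" using t i by simp
  have room: "?r * d i + 1 \<le> ?R * d i" using i(2) \<tau> by (simp add: field_simps)
  let ?B = "len_ball (?r * d i)"
  have near: "\<exists>k::int. \<exists>b\<in>?B. g = ?t [^] k \<otimes> b" if g: "g \<in> len_ball (?R * d i)" for g
  proof -
    have gc: "g \<in> carrier G" using g by (simp add: len_ball_def)
    consider "len g < ?r * d i" | "len (inv g \<otimes> ?t) < ?r * d i" | "len (inv g \<otimes> inv ?t) < ?r * d i"
      using near0 g t i by auto
    then show ?thesis
    proof cases
      case 1
      then show ?thesis using gc by (intro exI[of _ 0] bexI[of _ g]) (auto simp: len_ball_def)
    next
      case 2
      have "inv (inv g \<otimes> ?t) = inv ?t \<otimes> g" using gc tc by (simp add: inv_mult_group)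
      then have "inv ?t \<otimes> g \<in> ?B" using 2 gc tc word_length_inv[of "inv g \<otimes> ?t"]
        by (simp add: len_ball_def)
      then show ?thesis using gc tc by (intro exI[of _ 1] bexI[of _ "inv ?t \<otimes> g"]) auto
    next
      case 3
      have "inv (inv g \<otimes> inv ?t) = ?t \<otimes> g" using gc tc by (simp add: inv_mult_group)
      then have "?t \<otimes> g \<in> ?B" using 3 gc tc word_length_inv[of "inv g \<otimes> inv ?t"]
        by (simp add: len_ball_def)
      then show ?thesis using gc tc
        by (intro exI[of _ "-1"] bexI[of _ "?t \<otimes> g"]) (auto simp: int_pow_neg)
    qed
  qed
  have words: "set ws \<subseteq> S \<union> (\<lambda>s. inv s) ` S \<Longrightarrow> \<exists>k::int. \<exists>b\<in>?B. foldr (\<otimes>) ws \<one> = ?t [^] k \<otimes> b" for ws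
  proof (induction ws rule: rev_induct)
    case Nil
    have "\<one> \<in> ?B" using \<tau> d_pos[OF i(1)] by (simp add: len_ball_def)
    then show ?case by (intro exI[of _ 0] bexI[of _ \<one>]) auto
  next
    case (snoc s ws)
    obtain k :: int and b where b: "b \<in> ?B" "foldr (\<otimes>) ws \<one> = ?t [^] k \<otimes> b" using snoc by auto
    have sc: "s \<in> carrier G" "set ws \<subseteq> carrier G" using snoc.prems letters_closed[OF S_subset] by auto
    have bc: "b \<in> carrier G" using b by (simp add: len_ball_def)
    have "spells S [s] s" using snoc.prems sc by (simp add: spells_def)
    then have "len s \<le> 1" using word_length_le[OF S_subset, of "[s]" s] by simp
    then have "b \<otimes> s \<in> len_ball (?R * d i)"
      using len_mult_le[of b s] bc sc b(1) room by (simp add: len_ball_def)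
    then obtain m :: int and c where c: "c \<in> ?B" "b \<otimes> s = ?t [^] m \<otimes> c" using near by blast
    have "foldr (\<otimes>) (ws @ [s]) \<one> = ?t [^] k \<otimes> (b \<otimes> s)"
      using foldr_mult_append[of ws "[s]"] sc bc tc b(2) by (simp add: m_assoc del: foldr_append)
    also have "\<dots> = ?t [^] (k + m) \<otimes> c"
      using c tc by (simp add: int_pow_mult m_assoc len_ball_def)
    finally show ?case using c by blast
  qed
  show ?thesis
  proof (rule virtually_cyclicI[OF tc])
    show "finite ?B" by (rule finite_len_ball)
    show "?B \<subseteq> carrier G" by (auto simp: len_ball_def)
    show "\<exists>k::int. \<exists>b\<in>?B. g = ?t [^] k \<otimes> b" if "g \<in> carrier G" for g
    proof -
      have "g \<in> generate G S" using that generate_S by simp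
      from spells_exists[OF S_subset this] obtain ws where "spells S ws g" ..
      then have "set ws \<subseteq> S \<union> (\<lambda>s. inv s) ` S" and eq: "foldr (\<otimes>) ws \<one> = g"
        unfolding spells_def by blast+
      from words[OF this(1)] show ?thesis unfolding eq .
    qed
  qed
qed

end

section \<open>Excluding ascending directions by counting\<close>

text \<open>
  A maximal separated subset is a net.
\<close>

lemma separated_subset_or_net:
  assumes fin: "finite A" and sym: "\<And>x y. P x y \<Longrightarrow> P y x"
  shows "(\<exists>F\<subseteq>A. card F = M \<and> (\<forall>x\<in>F. \<forall>y\<in>F. x \<noteq> y \<longrightarrow> P x y)) \<or>
    (\<exists>F\<subseteq>A. card F < M \<and> (\<forall>x\<in>A. \<exists>y\<in>F. x = y \<or> \<not> P y x))"
proof -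
  define \<F> where "\<F> = {F. F \<subseteq> A \<and> (\<forall>x\<in>F. \<forall>y\<in>F. x \<noteq> y \<longrightarrow> P x y)}"
  have "finite \<F>" by (rule finite_subset[of _ "Pow A"]) (use fin in \<open>auto simp: \<F>_def\<close>)
  moreover have "\<F> \<noteq> {}" by (auto simp: \<F>_def)
  ultimately obtain F where F: "F \<in> \<F>" "\<And>F'. F' \<in> \<F> \<Longrightarrow> F \<subseteq> F' \<Longrightarrow> F' = F"
    using finite_has_maximal[of \<F>] by metis
  have finF: "finite F" using F fin finite_subset by (auto simp: \<F>_def)
  show ?thesis
  proof (cases "card F < M")
    case True
    have "\<exists>y\<in>F. x = y \<or> \<not> P y x" if x: "x \<in> A" for x
    proof (rule ccontr)
      assume n: "\<not> ?thesis"
      then have "insert x F \<in> \<F>" using F(1) x sym by (auto simp: \<F>_def)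
      then have "insert x F = F" using F(2) by blast
      then show False using n by blast
    qed
    moreover have "F \<subseteq> A" using F(1) by (auto simp: \<F>_def)
    ultimately show ?thesis using True by (intro disjI2 exI[of _ F] conjI ballI)
  next
    case False
    then have "M \<le> card F" by simp
    then obtain F' where F': "F' \<subseteq> F" "card F' = M" by (rule obtain_subset_with_card_n)
    have "F' \<subseteq> A" and "\<forall>x\<in>F'. \<forall>y\<in>F'. x \<noteq> y \<longrightarrow> P x y"
      using F(1) F'(1) by (auto simp: \<F>_def subset_iff)
    then show ?thesis using F'(2) by (intro disjI1 exI[of _ F'] conjI)
  qed
qed

context generated_group
begin

text \<open>
  A maximal separated set \<open>F\<close> has fewer than \<open>M\<close> elements, and every conjugate lies in a left or a
  right translate of the ball of radius \<open>\<rho>\<close> by the conjugate of an element of \<open>F\<close>. Conjugating back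
  preserves the number of elements of these translates.
\<close>

lemma card_ball_le_of_crowded_conjugates:
  assumes y: "y \<in> carrier G" and \<rho>: "0 < \<rho>"
    and crowded: "\<And>F. F \<subseteq> len_ball r \<Longrightarrow> card F = M \<Longrightarrow>
       \<exists>g\<in>F. \<exists>g'\<in>F. g \<noteq> g' \<and>
         (len (inv (inv y \<otimes> g \<otimes> y) \<otimes> (inv y \<otimes> g' \<otimes> y)) < \<rho> \<or>
          len ((inv y \<otimes> g \<otimes> y) \<otimes> inv (inv y \<otimes> g' \<otimes> y)) < \<rho>)"
  shows "card (len_ball r) \<le> 2 * (M - 1) * card (len_ball \<rho>)"
proof -
  define e where "e g = inv y \<otimes> g \<otimes> y" for g
  define P where "P g g' \<longleftrightarrow> g \<in> carrier G \<and> g' \<in> carrier G \<and>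
    \<rho> \<le> len (inv (e g) \<otimes> e g') \<and> \<rho> \<le> len (e g \<otimes> inv (e g'))" for g g'
  have ec: "e g \<in> carrier G" if "g \<in> carrier G" for g using that y by (simp add: e_def)
  have sym: "P g' g" if "P g g'" for g g'
  proof -
    have gc: "g \<in> carrier G" "g' \<in> carrier G" using that by (auto simp: P_def)
    have "inv (inv (e g) \<otimes> e g') = inv (e g') \<otimes> e g" "inv (e g \<otimes> inv (e g')) = e g' \<otimes> inv (e g)"
      using gc ec by (simp_all add: inv_mult_group)
    then show ?thesis
      using that gc ec word_length_inv[of "inv (e g) \<otimes> e g'"] word_length_inv[of "e g \<otimes> inv (e g')"]
      by (simp add: P_def)
  qed
  have "\<not> (\<exists>F\<subseteq>len_ball r. card F = M \<and> (\<forall>x\<in>F. \<forall>y\<in>F. x \<noteq> y \<longrightarrow> P x y))"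
  proof
    assume "\<exists>F\<subseteq>len_ball r. card F = M \<and> (\<forall>x\<in>F. \<forall>y\<in>F. x \<noteq> y \<longrightarrow> P x y)"
    then obtain F where F: "F \<subseteq> len_ball r" "card F = M" "\<And>x y. x \<in> F \<Longrightarrow> y \<in> F \<Longrightarrow> x \<noteq> y \<Longrightarrow> P x y"
      by blast
    from crowded[OF F(1,2)] obtain g g' where g: "g \<in> F" "g' \<in> F" "g \<noteq> g'"
      "len (inv (e g) \<otimes> e g') < \<rho> \<or> len (e g \<otimes> inv (e g')) < \<rho>"
      unfolding e_def by blast
    then show False using F(3)[of g g'] by (auto simp: P_def)
  qed
  then obtain F where F: "F \<subseteq> len_ball r" "card F < M"
    "\<And>g. g \<in> len_ball r \<Longrightarrow> \<exists>f\<in>F. g = f \<or> \<not> P f g"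
    using separated_subset_or_net[of "len_ball r" P M] finite_len_ball sym by metis
  have finF: "finite F" using F finite_len_ball finite_subset by blast
  let ?B = "len_ball \<rho>"
  define U where "U f = (\<lambda>b. f \<otimes> (y \<otimes> b \<otimes> inv y)) ` ?B \<union> (\<lambda>b. (y \<otimes> b \<otimes> inv y) \<otimes> f) ` ?B" for f
  have Ucard: "card (U f) \<le> 2 * card ?B" for f
    unfolding U_def by (rule order_trans[OF card_Un_le])
      (simp add: mult_2 add_mono card_image_le finite_len_ball)
  have "len_ball r \<subseteq> (\<Union>f\<in>F. U f)"
  proof
    fix g assume g: "g \<in> len_ball r"
    then obtain f where f: "f \<in> F" "g = f \<or> \<not> P f g" using F(3) by blast
    have c: "g \<in> carrier G" "f \<in> carrier G" using g f F(1) by (auto simp: len_ball_def)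
    have one: "\<one> \<in> ?B" using \<rho> by (simp add: len_ball_def)
    consider "g = f" | "len (inv (e f) \<otimes> e g) < \<rho>" | "len (e f \<otimes> inv (e g)) < \<rho>"
      using f c by (auto simp: P_def)
    then have "g \<in> U f"
    proof cases
      case 1
      then have "g = f \<otimes> (y \<otimes> \<one> \<otimes> inv y)" using c y by simp
      then show ?thesis using one by (auto simp: U_def)
    next
      case 2
      define b where "b = inv (e f) \<otimes> e g"
      have "b \<in> ?B" using 2 ec c by (simp add: b_def len_ball_def)
      moreover have "g = f \<otimes> (y \<otimes> b \<otimes> inv y)"
        using c y by (simp add: b_def e_def inv_mult_group m_assoc)
      ultimately show ?thesis by (auto simp: U_def)
    next
      case 3
      define b where "b = e g \<otimes> inv (e f)"
      have "inv (e f \<otimes> inv (e g)) = b" using ec c by (simp add: b_def inv_mult_group)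
      then have "b \<in> ?B" using 3 ec c word_length_inv[of "e f \<otimes> inv (e g)"]
        by (simp add: b_def len_ball_def)
      moreover have "g = (y \<otimes> b \<otimes> inv y) \<otimes> f"
        using c y by (simp add: b_def e_def inv_mult_group m_assoc)
      ultimately show ?thesis by (auto simp: U_def)
    qed
    then show "g \<in> (\<Union>f\<in>F. U f)" using f by blast
  qed
  then have "card (len_ball r) \<le> card (\<Union>f\<in>F. U f)"
    by (intro card_mono) (auto simp: finF U_def finite_len_ball)
  also have "\<dots> \<le> (\<Sum>f\<in>F. card (U f))" by (rule card_UN_le[OF finF])
  also have "\<dots> \<le> (\<Sum>f\<in>F. 2 * card ?B)" by (intro sum_mono Ucard)
  also have "\<dots> = card F * (2 * card ?B)" by simp
  also have "\<dots> \<le> (M - 1) * (2 * card ?B)" using F(2) by (intro mult_right_mono) auto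
  finally show ?thesis by (simp add: mult_ac)
qed

text \<open>
  The balls of radius \<open>\<rho>\<close> around separated points are disjoint.
\<close>

lemma card_ball_ge_of_separated:
  assumes W: "finite \<W>" "\<And>s. s \<in> \<W> \<Longrightarrow> W s \<in> len_ball r"
    and sep: "\<And>s s'. s \<in> \<W> \<Longrightarrow> s' \<in> \<W> \<Longrightarrow> s \<noteq> s' \<Longrightarrow> 2 * \<rho> < len (inv (W s) \<otimes> W s')"
  shows "card \<W> * card (len_ball \<rho>) \<le> card (len_ball (r + \<rho>))"
proof -
  have "inj_on (\<lambda>(s, g). W s \<otimes> g) (\<W> \<times> len_ball \<rho>)"
  proof (rule inj_onI, clarify)
    fix s g s' g'
    assume s: "s \<in> \<W>" "s' \<in> \<W>" and g: "g \<in> len_ball \<rho>" "g' \<in> len_ball \<rho>"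
      and eq: "W s \<otimes> g = W s' \<otimes> g'"
    have c: "W s \<in> carrier G" "W s' \<in> carrier G" "g \<in> carrier G" "g' \<in> carrier G"
      using W(2) s g by (auto simp: len_ball_def)
    have "s = s'"
    proof (rule ccontr)
      assume "s \<noteq> s'"
      have "inv (W s) \<otimes> W s' = inv (W s) \<otimes> ((W s' \<otimes> g') \<otimes> inv g')" using c by (simp add: m_assoc)
      also have "\<dots> = g \<otimes> inv g'" unfolding eq[symmetric] using c by (simp add: m_assoc)
      finally have "len (inv (W s) \<otimes> W s') \<le> len g + len g'"
        using len_mult_le[of g "inv g'"] c by simp
      then show False using sep[OF s \<open>s \<noteq> s'\<close>] g by (simp add: len_ball_def)
    qed
    then show "s = s' \<and> g = g'" using eq c by simp
  qed
  moreover have "(\<lambda>(s, g). W s \<otimes> g) ` (\<W> \<times> len_ball \<rho>) \<subseteq> len_ball (r + \<rho>)"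
  proof clarify
    fix s g assume "s \<in> \<W>" "g \<in> len_ball \<rho>"
    then show "W s \<otimes> g \<in> len_ball (r + \<rho>)"
      using W(2)[of s] len_mult_le[of "W s" g] by (auto simp: len_ball_def)
  qed
  ultimately have "card (\<W> \<times> len_ball \<rho>) \<le> card (len_ball (r + \<rho>))"
    by (rule card_inj_on_le) (rule finite_len_ball)
  then show ?thesis by (simp add: card_cartesian_product)
qed

end

lemma affine_less_power: "\<exists>N::nat. A * real N + B < 2 ^ N"
proof -
  obtain m :: nat where m: "2 * \<bar>A\<bar> + \<bar>B\<bar> < real m" using reals_Archimedean2 by blast
  have "A * real (2 * m) \<le> 2 * \<bar>A\<bar> * real m" by (simp add: mult_right_mono)
  moreover have "B \<le> \<bar>B\<bar> * (real m + 1)"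
    using mult_left_mono[of 1 "real m + 1" "\<bar>B\<bar>"] by simp
  ultimately have "A * real (2 * m) + B \<le> (2 * \<bar>A\<bar> + \<bar>B\<bar>) * (real m + 1)"
    by (simp add: algebra_simps) 
  also have "\<dots> \<le> real m * (real m + 1)" using m by (intro mult_right_mono) auto
  also have "\<dots> < (real m + 1) * (real m + 1)" by (intro mult_strict_right_mono) auto
  also have "\<dots> \<le> 2 ^ m * 2 ^ m"
  proof -
    have "Suc m \<le> 2 ^ m" by (induction m) auto
    then have "real (Suc m) \<le> real (2 ^ m)" by (simp only: of_nat_le_iff)
    then have "real m + 1 \<le> 2 ^ m" by simp
    then show ?thesis by (intro mult_mono) auto
  qed
  also have "\<dots> = 2 ^ (2 * m)" by (simp add: mult_2 power_add)
  finally show ?thesis by blast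
qed

context word_cone
begin

lemma conjugates_crowded_eventually:
  assumes sg: "separated_group cone_group cd sep"
    and asc: "separated_group.ascending cone_group cd sep b"
    and y: "y \<in> seqs" "separated_group.below cone_group sep b \<one>\<^bsub>cone_group\<^esub> y" "R < cd \<one>\<^bsub>cone_group\<^esub> y"
    and R: "0 \<le> R" and \<eta>: "0 < \<eta>" and M: "2 * (nat \<lfloor>R / \<eta>\<rfloor> + 1) < M"
  shows "eventually (\<lambda>i. card (len_ball (R * d i)) \<le> 2 * (M - 1) * card (len_ball (\<eta> * d i))) \<omega>"
proof -
  interpret sg: separated_group cone_group cd sep by (rule sg)
  define e where "e i g = inv (y i) \<otimes> g \<otimes> y i" for i g
  define crowded where "crowded i F \<longleftrightarrow> (\<exists>g\<in>F. \<exists>g'\<in>F. g \<noteq> g' \<and>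
      (len (inv (e i g) \<otimes> e i g') < \<eta> * d i \<or> len (e i g \<otimes> inv (e i g')) < \<eta> * d i))" for i F
  have "eventually (\<lambda>i. \<forall>F\<subseteq>len_ball (R * d i). card F = M \<longrightarrow> crowded i F) \<omega>"
  proof (rule ccontr)
    assume "\<not> ?thesis"
    from ultra[OF this]
    have ev: "eventually (\<lambda>i. \<exists>F\<subseteq>len_ball (R * d i). card F = M \<and> \<not> crowded i F) \<omega>" by simp
    define F where "F i = (SOME F. F \<subseteq> len_ball (R * d i) \<and> card F = M \<and> \<not> crowded i F)" for i
    have F: "eventually (\<lambda>i. F i \<subseteq> len_ball (R * d i) \<and> card (F i) = M \<and> \<not> crowded i (F i)) \<omega>"
      using ev
    proof eventually_elim
      case (elim i)
      then show ?case unfolding F_def by (rule someI_ex)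
    qed
    have "\<exists>h. F i \<subseteq> len_ball (R * d i) \<and> card (F i) = M \<longrightarrow> bij_betw h {..<M} (F i)" for i
      using ex_bij_betw_nat_finite[of "F i"] finite_len_ball[of "R * d i"] finite_subset
      by (auto simp: lessThan_atLeast0)
    then obtain h where h: "\<And>i. F i \<subseteq> len_ball (R * d i) \<Longrightarrow> card (F i) = M \<Longrightarrow> bij_betw (h i) {..<M} (F i)"
      by metis
    have "\<exists>g\<in>seqs. eventually (\<lambda>i. g i = h i j) \<omega> \<and> cd \<one>\<^bsub>cone_group\<^esub> g \<le> R" if j: "j < M" for j
    proof (rule seq_of_eventually)
      show "eventually (\<lambda>i. h i j \<in> carrier G \<and> len (h i j) \<le> R * d i) \<omega>"
        using F
      proof eventually_elim
        case (elim i)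
        then have "h i j \<in> F i" using h j by (auto simp: bij_betw_def)
        then show ?case using elim by (auto simp: len_ball_def)
      qed
    qed
    then have "\<forall>j\<in>{..<M}. \<exists>g. g \<in> seqs \<and> eventually (\<lambda>i. g i = h i j) \<omega> \<and> cd \<one>\<^bsub>cone_group\<^esub> g \<le> R"
      by blast
    from bchoice[OF this] obtain g where
      g: "\<And>j. j < M \<Longrightarrow> g j \<in> seqs" "\<And>j. j < M \<Longrightarrow> eventually (\<lambda>i. g j i = h i j) \<omega>"
        "\<And>j. j < M \<Longrightarrow> cd \<one>\<^bsub>cone_group\<^esub> (g j) \<le> R" by blast
    define E where "E j = inv\<^bsub>cone_group\<^esub> y \<otimes>\<^bsub>cone_group\<^esub> g j \<otimes>\<^bsub>cone_group\<^esub> y" for j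
    have E: "E j \<in> seqs" if "j < M" for j using that g y by (simp add: E_def)
    have E_app: "E j i = e i (g j i)" if "i \<in> I" for j i using that y by (simp add: E_def e_def)
    have "\<exists>j<M. \<exists>k<M. j \<noteq> k \<and>
        (cd (E j) (E k) < \<eta> \<or> cd (inv\<^bsub>cone_group\<^esub> E j) (inv\<^bsub>cone_group\<^esub> E k) < \<eta>)"
      unfolding E_def
      by (rule sg.conjugate_crowding[OF asc R \<eta>, unfolded carrier_cone_group, OF y g(1,3) M])
    then obtain j k where jk: "j < M" "k < M" "j \<noteq> k"
      and close: "cd (E j) (E k) < \<eta> \<or> cd (inv\<^bsub>cone_group\<^esub> E j) (inv\<^bsub>cone_group\<^esub> E k) < \<eta>"
      by blast
    have "eventually (\<lambda>i. len (inv (e i (g j i)) \<otimes> e i (g k i)) < \<eta> * d i \<or>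
        len (e i (g j i) \<otimes> inv (e i (g k i))) < \<eta> * d i) \<omega>"
    proof (cases "cd (E j) (E k) < \<eta>")
      case True
      from cd_less_eventually[OF E[OF jk(1)] E[OF jk(2)] True] ev_index
      show ?thesis by eventually_elim (simp add: E_app)
    next
      case False
      then have "cd (inv\<^bsub>cone_group\<^esub> E j) (inv\<^bsub>cone_group\<^esub> E k) < \<eta>" using close by blast
      from cd_less_eventually[OF _ _ this] E jk ev_index
      have "eventually (\<lambda>i. len (inv ((inv\<^bsub>cone_group\<^esub> E j) i) \<otimes> (inv\<^bsub>cone_group\<^esub> E k) i) < \<eta> * d i) \<omega>"
        by simp
      then show ?thesis using ev_index
      proof eventually_elim
        case (elim i)
        have "e i (g j i) \<in> carrier G" using E[OF jk(1)] E_app elim(2) by (metis seqs_closed)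
        then show ?case using elim E jk by (simp add: E_app)
      qed
    qed
    with F g(2)[OF jk(1)] g(2)[OF jk(2)] have "eventually (\<lambda>i. False) \<omega>"
    proof eventually_elim
      case (elim i)
      have b: "bij_betw (h i) {..<M} (F i)" using h elim by blast
      then have "h i j \<in> F i" "h i k \<in> F i" "h i j \<noteq> h i k"
        using jk by (auto simp: bij_betw_def inj_on_def)
      then have "crowded i (F i)" using elim unfolding crowded_def by metis
      then show ?case using elim by blast
    qed
    then show False using \<omega>_nonbot by (simp add: eventually_False)
  qed
  then show ?thesis using ev_index
  proof eventually_elim
    case (elim i)
    show ?case
      by (rule card_ball_le_of_crowded_conjugates[of "y i"])
        (use elim y \<eta> d_pos in \<open>auto simp: crowded_def e_def\<close>)
  qed
qed

text \<open>
  With \<open>\<eta>\<close> fixed, the words of length \<open>N\<close> in the two descending elements lie in a ball whose radius \<open>R\<close>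
  is linear in \<open>N\<close>, and their \<open>2\<^sup>N\<close> disjoint balls of radius \<open>\<eta>\<close> are more than the balls of
  that radius needed to cover a conjugate of the ball of radius \<open>R\<close>, whose number is linear in
  \<open>R\<close>.
\<close>

lemma not_ascending:
  assumes sg: "separated_group cone_group cd sep"
    and asc: "separated_group.ascending cone_group cd sep b"
    and nline: "\<not> separated_group.linear_betweenness cone_group cd sep"
  shows False
proof -
  interpret sg: separated_group cone_group cd sep by (rule sg)
  obtain h where h: "h \<in> seqs" "0 < cd \<one>\<^bsub>cone_group\<^esub> h"
    "\<not> sg.below b \<one>\<^bsub>cone_group\<^esub> h" "\<not> sg.below b h \<one>\<^bsub>cone_group\<^esub>"
    using sg.exists_incomparable[OF asc nline] by auto
  define \<eta> where "\<eta> = cd \<one>\<^bsub>cone_group\<^esub> h / 4"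
  have \<eta>: "0 < \<eta>" "2 * \<eta> < cd \<one>\<^bsub>cone_group\<^esub> h" using h by (auto simp: \<eta>_def)
  obtain \<delta> :: "bool \<Rightarrow> 'i \<Rightarrow> 'a" where \<delta>: "\<And>c. \<delta> c \<in> seqs"
    and \<delta>_sep: "\<And>s s'. length s = length s' \<Longrightarrow> s \<noteq> s' \<Longrightarrow>
       cd \<one>\<^bsub>cone_group\<^esub> h \<le> cd (foldr (\<otimes>\<^bsub>cone_group\<^esub>) (map \<delta> s) \<one>\<^bsub>cone_group\<^esub>)
          (foldr (\<otimes>\<^bsub>cone_group\<^esub>) (map \<delta> s') \<one>\<^bsub>cone_group\<^esub>)"
    using sg.separated_words[OF asc, of h] h by auto
  define W where "W s = foldr (\<otimes>\<^bsub>cone_group\<^esub>) (map \<delta> s) \<one>\<^bsub>cone_group\<^esub>" for s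
  have W: "W s \<in> seqs" for s
    using \<Gamma>.foldr_mult_closed[of "map \<delta> s"] \<delta> by (auto simp: W_def)
  define L where "L = max (cd \<one>\<^bsub>cone_group\<^esub> (\<delta> True)) (cd \<one>\<^bsub>cone_group\<^esub> (\<delta> False))"
  have L: "cd \<one>\<^bsub>cone_group\<^esub> (\<delta> c) \<le> L" for c by (cases c) (auto simp: L_def)
  then have L0: "0 \<le> L" using cd_nonneg[OF one_seqs \<delta>] order_trans by blast
  have W_len: "cd \<one>\<^bsub>cone_group\<^esub> (W s) \<le> real (length s) * L" for s
  proof (induction s)
    case (Cons c s)
    have "W (c # s) = \<delta> c \<otimes>\<^bsub>cone_group\<^esub> W s" by (simp add: W_def)
    then have "cd \<one>\<^bsub>cone_group\<^esub> (W (c # s)) \<le> cd \<one>\<^bsub>cone_group\<^esub> (\<delta> c) + cd \<one>\<^bsub>cone_group\<^esub> (W s)"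
      using cd_triangle[of "\<one>\<^bsub>cone_group\<^esub>" "\<delta> c" "W (c # s)"] cd_left[of "\<delta> c" "\<one>\<^bsub>cone_group\<^esub>" "W s"] \<delta> W
      by simp
    then show ?case using Cons L[of c] by (simp add: algebra_simps)
  qed (simp add: W_def cd_refl)
  \<comment> \<open>The left-hand side bounds \<open>2 (M - 1)\<close>, with the \<open>R\<close> and \<open>M\<close> defined next.\<close>
  obtain N :: nat where N: "4 * L / \<eta> * real N + (4 * (1 + \<eta>) / \<eta> + 4) < 2 ^ N"
    using affine_less_power by blast
  define R where "R = (real N * L + 1) + \<eta>"
  have R: "0 \<le> R" using L0 \<eta> by (simp add: R_def)
  define M where "M = 2 * (nat \<lfloor>R / \<eta>\<rfloor> + 1) + 1"
  obtain y where y: "y \<in> seqs" "sg.below b \<one>\<^bsub>cone_group\<^esub> y" "R < cd \<one>\<^bsub>cone_group\<^esub> y"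
    using sg.exists_high[OF asc, of R] by auto
  have upper: "eventually (\<lambda>i. card (len_ball (R * d i)) \<le> 2 * (M - 1) * card (len_ball (\<eta> * d i))) \<omega>"
    by (rule conjugates_crowded_eventually[OF sg asc y R \<eta>(1)]) (simp add: M_def)
  define \<W> where "\<W> = {s :: bool list. length s = N}"
  have fin: "finite \<W>" and card\<W>: "card \<W> = 2 ^ N"
    using finite_lists_length_eq[of "UNIV :: bool set" N] card_lists_length_eq[of "UNIV :: bool set" N]
    by (simp_all add: \<W>_def)
  have "eventually (\<lambda>i. \<forall>s\<in>\<W>. len (W s i) < (real N * L + 1) * d i) \<omega>"
  proof (rule eventually_ball_finite[OF fin], rule ballI)
    fix s assume "s \<in> \<W>"
    then have "cd \<one>\<^bsub>cone_group\<^esub> (W s) < real N * L + 1" using W_len[of s] by (simp add: \<W>_def)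
    then show "eventually (\<lambda>i. len (W s i) < (real N * L + 1) * d i) \<omega>"
      by (rule cd_one_less_eventually[OF W])
  qed
  moreover have "eventually (\<lambda>i. \<forall>s\<in>\<W>. \<forall>s'\<in>\<W>. s \<noteq> s' \<longrightarrow> 2 * \<eta> * d i < len (inv (W s i) \<otimes> W s' i)) \<omega>"
  proof (intro eventually_ball_finite[OF fin] ballI)
    fix s s' assume s: "s \<in> \<W>" "s' \<in> \<W>"
    show "eventually (\<lambda>i. s \<noteq> s' \<longrightarrow> 2 * \<eta> * d i < len (inv (W s i) \<otimes> W s' i)) \<omega>"
    proof (cases "s = s'")
      case False
      then have "2 * \<eta> < cd (W s) (W s')" using \<delta>_sep[of s s'] s \<eta> by (simp add: \<W>_def W_def)
      from cd_greater_eventually[OF W W this] show ?thesis by (auto elim: eventually_mono)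
    qed simp
  qed
  ultimately have "eventually (\<lambda>i. False) \<omega>" using upper ev_index
  proof eventually_elim
    case (elim i)
    have "card \<W> * card (len_ball (\<eta> * d i)) \<le> card (len_ball ((real N * L + 1) * d i + \<eta> * d i))"
    proof (rule card_ball_ge_of_separated[OF fin, where W = "\<lambda>s. W s i"])
      show "W s i \<in> len_ball ((real N * L + 1) * d i)" if "s \<in> \<W>" for s
        using that elim W by (auto simp: len_ball_def less_imp_le)
      show "2 * (\<eta> * d i) < len (inv (W s i) \<otimes> W s' i)" if "s \<in> \<W>" "s' \<in> \<W>" "s \<noteq> s'" for s s'
        using that elim by (simp add: mult.assoc)
    qed
    also have "(real N * L + 1) * d i + \<eta> * d i = R * d i" by (simp add: R_def algebra_simps)
    also have "card (len_ball (R * d i)) \<le> 2 * (M - 1) * card (len_ball (\<eta> * d i))" using elim by blast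
    finally have "2 ^ N * card (len_ball (\<eta> * d i)) \<le> 2 * (M - 1) * card (len_ball (\<eta> * d i))"
      by (simp add: card\<W>)
    moreover have "0 < card (len_ball (\<eta> * d i))"
    proof -
      have "\<one> \<in> len_ball (\<eta> * d i)" using \<eta> d_pos[of i] elim by (simp add: len_ball_def)
      then show ?thesis using finite_len_ball card_gt_0_iff by blast
    qed
    ultimately have "2 ^ N \<le> 2 * (M - 1)" by simp
    then have "real (2 ^ N) \<le> real (2 * (M - 1))" by (simp only: of_nat_le_iff)
    then have "2 ^ N \<le> 4 * (real (nat \<lfloor>R / \<eta>\<rfloor>) + 1)" by (simp add: M_def)
    moreover have "real (nat \<lfloor>R / \<eta>\<rfloor>) \<le> R / \<eta>" using R \<eta> by simp
    then have "4 * (real (nat \<lfloor>R / \<eta>\<rfloor>) + 1) \<le> 4 * (R / \<eta> + 1)" by simp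
    ultimately have "2 ^ N \<le> 4 * (R / \<eta> + 1)" by (rule order_trans)
    also have "\<dots> = 4 * L / \<eta> * real N + (4 * (1 + \<eta>) / \<eta> + 4)"
      using \<eta> by (simp add: R_def field_simps)
    finally show ?case using N by simp
  qed
  then show False using \<omega>_nonbot by (simp add: eventually_False)
qed

end

theorem corollary6p14:
  fixes G :: "('a, 'b) monoid_scheme" and n :: nat and w :: word_in_letters
  assumes "finitely_generated_group G"
    and "\<not> virtually_cyclic G"
    and "is_law n w"
    and "satisfies_law G n w"
  shows "wide TYPE('i) G"
  unfolding wide_def
proof (intro allI impI notI)
  fix S and I :: "'i set" and \<omega> d
  assume S: "finite_generating_set G S" and uf: "nonprincipal_ultrafilter_on I \<omega>"
    and sc: "scaling_sequence I \<omega> d"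
    and cut: "has_global_cut_point
      (mtopology_of (asymptotic_cone (word_metric G S) I \<omega> (\<lambda>_. \<one>\<^bsub>G\<^esub>) d))"
  interpret group G using assms(1) by (simp add: finitely_generated_group_def)
  interpret word_cone G S I \<omega> d by unfold_locales (fact S uf sc)+
  have sg: "separated_group cone_group cd sep"
    using separated_group_cone[OF cut] infinite_if_not_virtually_cyclic assms(2) by blast
  have "\<not> separated_group.linear_betweenness cone_group cd sep"
    using virtually_cyclic_of_line[OF sg] assms(2) by blast
  moreover have "satisfies_law cone_group n w" by (rule cone_group_satisfies_law) fact+
  ultimately show False
    using separated_group.law_imp_line_or_ascending[OF sg assms(3)] not_ascending[OF sg] by blast
qed

end
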